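(* Let $n\ge 3$ and $C\ge 1$. For each integer $m\ge 100$ let $\mathcal{G}_m$ be the Dirichlet Green's function in the unit ball $B(0,1)\subset\mathbb{R}^n$ of the operator $L_m u=-\nabla\cdot(\nabla u)+\mathcal{B}_m\cdot\nabla u$, where $\mathcal{B}_m(x)=-\frac{C}{1-|x|}\frac{x}{|x|}$ for $0<|x|\le 1-\frac1m$ and $\mathcal{B}_m(x)=-Cm\frac{x}{|x|}$ for $1-\frac1m<|x|<1$. Then there is a constant $c_0>0$, independent of $m$, such that for every $m\ge 100$ and all $y,z\in B(0,1)$ with $y\ne z$ and $|z-y|\le\frac12\delta(y)$, where $\delta(y)=\operatorname{dist}(y,\partial B(0,1))$, $$\mathcal{G}_m(y,z)\ge \frac{c_0}{|z-y|^{n-2}} .$$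
   Context: Here $B(0,1)$ is the open unit ball of $\mathbb{R}^n$ centered at the origin. For each $m$ the drift $\mathcal{B}_m$ is bounded. The Green's function associated with $L_m$ is the unique non-negative function $\mathcal{G}_m:B(0,1)\times B(0,1)\to\mathbb{R}\cup\{\infty\}$ such that, for every $y\in B(0,1)$: (1) for all $s>0$, $\mathcal{G}_m(\cdot,y)\in C(B(0,1)\setminus B(y,s))\cap W^{1,2}(B(0,1)\setminus B(y,s))\cap W^{1,1}(B(0,1))$; (2) $\int_{B(0,1)}\big(\nabla_x\mathcal{G}_m(x,y)\cdot\nabla\phi(x)+\mathcal{B}_m(x)\cdot\nabla_x\mathcal{G}_m(x,y)\,\phi(x)\big)\,dx=\phi(y)$ for all $\phi\in C_c^\infty(B(0,1))$; (3) $\mathcal{G}_m(\cdot,y)$ vanishes on the boundary $\partial B(0,1)$ (Dirichlet condition, in the sense of zero trace). The second argument is the pole for $L_m$. *)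

theory Defs
  imports "HOL-Analysis.Analysis"
begin

section \<open>Test functions\<close>

definition grad :: "('a::euclidean_space \<Rightarrow> real) \<Rightarrow> 'a \<Rightarrow> 'a" where
  "grad f x = (\<Sum>i\<in>Basis. frechet_derivative f (at x) i *\<^sub>R i)"

primrec C_k :: "nat \<Rightarrow> ('a::euclidean_space \<Rightarrow> real) \<Rightarrow> bool" where
  "C_k 0 f \<longleftrightarrow> continuous_on UNIV f"
| "C_k (Suc k) f \<longleftrightarrow>
     (\<forall>x. f differentiable (at x)) \<and> (\<forall>i\<in>Basis. C_k k (\<lambda>x. grad f x \<bullet> i))"

text \<open>Elements of \<open>C\<^sub>c\<^sup>\<infinity>(\<Omega>)\<close> are regarded as functions on the whole space,
  extended by zero.\<close>

definition test_functions :: "'a::euclidean_space set \<Rightarrow> ('a \<Rightarrow> real) set" where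
  "test_functions \<Omega> =
     {\<phi>. (\<forall>k. C_k k \<phi>) \<and> compact (closure {x. \<phi> x \<noteq> 0}) \<and> closure {x. \<phi> x \<noteq> 0} \<subseteq> \<Omega>}"


section \<open>Sobolev spaces on open sets\<close>

text \<open>Functions are total; only their values on \<open>\<Omega>\<close> matter. Local integrability is required
  explicitly in the definition of a weak gradient, because the integral of a non-integrable
  function is \<open>0\<close> by convention.\<close>

definition Lp_space :: "real \<Rightarrow> 'a::euclidean_space set \<Rightarrow> ('a \<Rightarrow> 'b::euclidean_space) set" where
  "Lp_space p \<Omega> =
     {f. f \<in> borel_measurable (lebesgue_on \<Omega>) \<and>
         integrable (lebesgue_on \<Omega>) (\<lambda>x. norm (f x) powr p)}"

definition locally_integrable_on ::
    "('a::euclidean_space \<Rightarrow> 'b::euclidean_space) \<Rightarrow> 'a set \<Rightarrow> bool" where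
  "locally_integrable_on f \<Omega> \<longleftrightarrow> (\<forall>K. compact K \<and> K \<subseteq> \<Omega> \<longrightarrow> integrable (lebesgue_on K) f)"

definition is_weak_gradient ::
    "'a::euclidean_space set \<Rightarrow> ('a \<Rightarrow> real) \<Rightarrow> ('a \<Rightarrow> 'a) \<Rightarrow> bool" where
  "is_weak_gradient \<Omega> u g \<longleftrightarrow>
     locally_integrable_on u \<Omega> \<and> locally_integrable_on g \<Omega> \<and>
     (\<forall>\<phi>\<in>test_functions \<Omega>. \<forall>i\<in>Basis.
        (LINT x|lebesgue_on \<Omega>. u x * (grad \<phi> x \<bullet> i)) =
        - (LINT x|lebesgue_on \<Omega>. (g x \<bullet> i) * \<phi> x))"

text \<open>A representative of the weak gradient, which is unique up to null sets where it exists.\<close>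

definition weak_grad :: "'a::euclidean_space set \<Rightarrow> ('a \<Rightarrow> real) \<Rightarrow> 'a \<Rightarrow> 'a" where
  "weak_grad \<Omega> u = (SOME g. is_weak_gradient \<Omega> u g)"

definition W1p :: "real \<Rightarrow> 'a::euclidean_space set \<Rightarrow> ('a \<Rightarrow> real) set" where
  "W1p p \<Omega> = {u. u \<in> Lp_space p \<Omega> \<and> (\<exists>g. is_weak_gradient \<Omega> u g \<and> g \<in> Lp_space p \<Omega>)}"

text \<open>The closure of \<open>C\<^sub>c\<^sup>\<infinity>(\<Omega>)\<close> in \<open>W\<^sup>1\<^sup>,\<^sup>p(\<Omega>)\<close>: the Sobolev functions with zero
  trace.\<close>

definition W1p_zero_trace :: "real \<Rightarrow> 'a::euclidean_space set \<Rightarrow> ('a \<Rightarrow> real) set" where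
  "W1p_zero_trace p \<Omega> =
     {u \<in> W1p p \<Omega>. \<exists>\<phi>. (\<forall>k. \<phi> k \<in> test_functions \<Omega>) \<and>
        (\<lambda>k::nat. (LINT x|lebesgue_on \<Omega>. \<bar>u x - \<phi> k x\<bar> powr p) +
                  (LINT x|lebesgue_on \<Omega>. norm (weak_grad \<Omega> u x - grad (\<phi> k) x) powr p))
          \<longlonglongrightarrow> 0}"


section \<open>The Dirichlet Green's function of the unit ball\<close>

text \<open>\<open>is_Green_function b G\<close>: \<open>G\<close> is the Green's function of \<open>u \<mapsto> - \<Delta>u + b \<bullet> \<nabla>u\<close> in
  \<open>ball 0 1\<close>; the second argument of \<open>G\<close> is the pole. Off the pole \<open>G\<close> is finite (it is
  continuous there as a real-valued function). The conditions leave the value at the pole open.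
  The Sobolev space on the relatively closed set \<open>ball 0 1 - ball y s\<close> is the one on its
  interior.\<close>

definition is_Green_function ::
    "('a::euclidean_space \<Rightarrow> 'a) \<Rightarrow> ('a \<Rightarrow> 'a \<Rightarrow> ereal) \<Rightarrow> bool" where
  "is_Green_function b G \<longleftrightarrow>
     (\<forall>x\<in>ball 0 1. \<forall>y\<in>ball 0 1. 0 \<le> G x y) \<and>
     (\<forall>y\<in>ball 0 1.
        let u = (\<lambda>x. real_of_ereal (G x y)); Du = weak_grad (ball 0 1) u in
        (\<forall>s>0. (\<forall>x\<in>ball 0 1 - ball y s. G x y \<noteq> \<infinity>) \<and>
               continuous_on (ball 0 1 - ball y s) u \<and>
               u \<in> W1p 2 (interior (ball 0 1 - ball y s)) \<and>
               u \<in> W1p 1 (ball 0 1)) \<and>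
        (\<forall>\<phi>\<in>test_functions (ball 0 1).
           (LINT x|lebesgue_on (ball 0 1). Du x \<bullet> grad \<phi> x + (b x \<bullet> Du x) * \<phi> x) = \<phi> y) \<and>
        u \<in> W1p_zero_trace 1 (ball 0 1))"

text \<open>\<open>sgn x = x / \<bar>x\<bar>\<close> for \<open>x \<noteq> 0\<close>, and \<open>sgn 0 = 0\<close>; only the values on \<open>ball 0 1\<close> are
  used.\<close>

definition drift :: "real \<Rightarrow> nat \<Rightarrow> 'a::euclidean_space \<Rightarrow> 'a" where
  "drift C m x =
     (if norm x \<le> 1 - 1 / real m then - (C / (1 - norm x)) *\<^sub>R sgn x
      else - (C * real m) *\<^sub>R sgn x)"

end

theory Submission
  imports Defs
begin

text \<open>
The Green's function \<open>u = G(\<cdot>, z)\<close> is nonnegative and satisfies the equation only weakly, and the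
estimate must hold at a single point \<open>y\<close>. The proof is by duality: the equation is tested with one
compactly supported function \<open>\<phi>\<close> that is a subsolution of the adjoint equation except for a defect
concentrated near \<open>y\<close>. Moving all derivatives to \<open>\<phi>\<close> and using \<open>u \<ge> 0\<close> gives
\<open>\<phi> z \<le> const * sup u\<close>, the supremum being taken over a tiny ball about \<open>y\<close>; continuity of \<open>u\<close> at \<open>y\<close>
turns the supremum into \<open>u y\<close>.

The adjoint equation contains the divergence of the drift, which is singular at the origin. This is
avoided because the drift is radial, hence a gradient \<open>- \<nabla> W\<close>: with \<open>\<phi> = exp W * \<psi>\<close> the condition
on \<open>\<psi>\<close> is \<open>\<Delta> \<psi> + \<nabla> W \<bullet> \<nabla> \<psi> \<ge> 0\<close>, which involves only the size of \<open>\<nabla> W\<close>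
(\<open>weighted_weak_form\<close>). On the ball of radius \<open>3/4 \<delta>(y)\<close> about \<open>y\<close> this size is at most
\<open>K = 12 C / \<delta>(y)\<close>, for every \<open>m\<close>, because the truncation at level \<open>m\<close> only makes the drift smaller.

A radial \<open>\<psi>\<close> with derivative \<open>- (r powr (1 - n)) * exp (- K r)\<close> is a subsolution for every drift of
size at most \<open>K\<close>. As \<open>K \<delta>(y) = 12 C\<close>, the exponential is bounded below on the relevant
scale and \<open>\<psi> z\<close> is at least a constant times \<open>\<bar>z - y\<bar> powr (2 - n)\<close>. Truncation at the outer radius
by a smooth convex function, and rounding in a core ball about \<open>y\<close>, make \<open>\<psi>\<close> a test function; the core contributes a defect of
bounded total mass (\<open>barrier_exists\<close>). Finally \<open>W\<close> itself is not smooth, so it is replaced by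
polynomials in \<open>\<bar>x\<bar>\<^sup>2\<close> whose gradients converge to \<open>\<nabla> W\<close> boundedly (\<open>drift_potential\<close>), and the
resulting error is removed by dominated convergence (\<open>barrier_test_inequality\<close>).
\<close>

section \<open>Calculus of smooth functions\<close>

lemma GDERIV_imp_grad:
  fixes f :: "'a::euclidean_space \<Rightarrow> real"
  assumes "GDERIV f x :> D"
  shows "grad f x = D"
proof -
  have "(f has_derivative (\<lambda>h. h \<bullet> D)) (at x)"
    using assms by (simp add: gderiv_def)
  then have "frechet_derivative f (at x) = (\<lambda>h. h \<bullet> D)"
    by (metis frechet_derivative_at)
  then show ?thesis
    by (simp add: grad_def inner_commute[of _ D] euclidean_representation)
qed

lemma differentiable_imp_GDERIV:
  fixes f :: "'a::euclidean_space \<Rightarrow> real"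
  assumes "f differentiable (at x)"
  shows "GDERIV f x :> grad f x"
proof -
  have d: "(f has_derivative frechet_derivative f (at x)) (at x)"
    using assms frechet_derivative_works by blast
  then interpret bounded_linear "frechet_derivative f (at x)"
    by (rule has_derivative_bounded_linear)
  have "frechet_derivative f (at x) h = h \<bullet> grad f x" for h
  proof -
    have "frechet_derivative f (at x) h = frechet_derivative f (at x) (\<Sum>i\<in>Basis. (h \<bullet> i) *\<^sub>R i)"
      by (simp add: euclidean_representation)
    also have "\<dots> = h \<bullet> grad f x"
      by (simp add: sum scaleR grad_def inner_sum_right mult.commute)
    finally show ?thesis .
  qed
  then have "frechet_derivative f (at x) = (\<lambda>h. h \<bullet> grad f x)" by auto
  with d show ?thesis by (simp add: gderiv_def)
qed

lemma C_k_SucI: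
  assumes "\<And>x. GDERIV f x :> D x" and "\<And>i. i \<in> Basis \<Longrightarrow> C_k k (\<lambda>x. D x \<bullet> i)"
  shows "C_k (Suc k) f"
proof -
  have "grad f = D" using GDERIV_imp_grad[OF assms(1)] by auto
  moreover have "f differentiable (at x)" for x
    using assms(1)[of x] unfolding gderiv_def differentiable_def by blast
  ultimately show ?thesis using assms(2) by simp
qed

lemma C_k_SucD:
  assumes "C_k (Suc k) f"
  shows "GDERIV f x :> grad f x" and "i \<in> Basis \<Longrightarrow> C_k k (\<lambda>x. grad f x \<bullet> i)"
  using assms by (auto intro: differentiable_imp_GDERIV)

lemma GDERIV_continuous_on:
  assumes "\<And>x. GDERIV f x :> D x"
  shows "continuous_on UNIV f"
  using assms unfolding gderiv_def
  by (meson continuous_at_imp_continuous_on has_derivative_continuous)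

lemma C_k_Suc_imp: "C_k (Suc k) f \<Longrightarrow> C_k k f"
proof (induction k arbitrary: f)
  case 0
  then show ?case using GDERIV_continuous_on[OF C_k_SucD(1)[OF 0]] by simp
next
  case (Suc k)
  show ?case
    by (rule C_k_SucI[OF C_k_SucD(1)[OF Suc.prems]], rule Suc.IH, rule C_k_SucD(2)[OF Suc.prems])
qed

lemma C_k_const: "C_k k (\<lambda>x::'a::euclidean_space. c)"
proof (induction k arbitrary: c)
  case (Suc k)
  have "GDERIV (\<lambda>x::'a. c) x :> 0" for x by (rule GDERIV_const)
  then show ?case by (rule C_k_SucI) (simp add: Suc.IH)
qed simp

lemma C_k_add: "C_k k f \<Longrightarrow> C_k k g \<Longrightarrow> C_k k (\<lambda>x. f x + g x)"
proof (induction k arbitrary: f g)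
  case 0 then show ?case by (auto intro: continuous_intros)
next
  case (Suc k)
  show ?case
    by (rule C_k_SucI[OF GDERIV_add[OF C_k_SucD(1)[OF Suc.prems(1)] C_k_SucD(1)[OF Suc.prems(2)]]])
       (unfold inner_add_left, intro Suc.IH C_k_SucD(2)[OF Suc.prems(1)] C_k_SucD(2)[OF Suc.prems(2)])
qed

text \<open>The product rule involves the undifferentiated factors, which have one more derivative than
required: this is why \<^const>\<open>C_k\<close> has to be antitone in \<open>k\<close> first.\<close>

lemma C_k_mult: "C_k k f \<Longrightarrow> C_k k g \<Longrightarrow> C_k k (\<lambda>x. f x * g x)"
proof (induction k arbitrary: f g)
  case 0 then show ?case by (auto intro: continuous_intros)
next
  case (Suc k)
  show ?case
    by (rule C_k_SucI[OF GDERIV_mult[OF C_k_SucD(1)[OF Suc.prems(1)] C_k_SucD(1)[OF Suc.prems(2)]]])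
       (unfold inner_add_left inner_scaleR_left,
        intro C_k_add Suc.IH C_k_SucD(2)[OF Suc.prems(1)] C_k_SucD(2)[OF Suc.prems(2)]
          C_k_Suc_imp[OF Suc.prems(1)] C_k_Suc_imp[OF Suc.prems(2)])
qed

lemma C_k_compose:
  fixes g :: "real \<Rightarrow> real" and f :: "'a::euclidean_space \<Rightarrow> real"
  shows "C_k k g \<Longrightarrow> C_k k f \<Longrightarrow> C_k k (\<lambda>x. g (f x))"
proof (induction k arbitrary: g)
  case 0 then show ?case
    by (auto intro: continuous_on_compose2)
next
  case (Suc k)
  have g: "DERIV g t :> grad g t" for t
    using C_k_SucD(1)[OF Suc.prems(1)] by (simp add: gderiv_deriv)
  have g': "C_k k (grad g)" using C_k_SucD(2)[OF Suc.prems(1), of 1] by simp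
  show ?case
    by (rule C_k_SucI[OF GDERIV_DERIV_compose[OF C_k_SucD(1)[OF Suc.prems(2)] g]])
       (unfold inner_scaleR_left,
        intro C_k_mult Suc.IH[OF g'] C_k_SucD(2)[OF Suc.prems(2)] C_k_Suc_imp[OF Suc.prems(2)])
qed

text \<open>Members of \<^const>\<open>test_functions\<close> have to be \<^const>\<open>C_k\<close> for all \<open>k\<close>; this predicate is closed
under all constructions below, so every concrete test function is smooth by composition.\<close>

definition smooth :: "('a::euclidean_space \<Rightarrow> real) \<Rightarrow> bool" where
  "smooth f \<longleftrightarrow> (\<forall>k. C_k k f)"

text \<open>It serves for compositions \<open>N (p x)\<close> with \<open>p > 0\<close>, where \<open>N\<close> is an antiderivative controlled on
\<open>{0<..}\<close> only: the gradient is an explicit smooth function.\<close>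

lemma smoothI_grad:
  assumes "\<And>x. GDERIV f x :> D x" and "\<And>i. i \<in> Basis \<Longrightarrow> smooth (\<lambda>x. D x \<bullet> i)"
  shows "smooth f"
  unfolding smooth_def
proof
  fix k
  have "C_k (Suc k) f" using C_k_SucI[OF assms(1)] assms(2) by (auto simp: smooth_def)
  then show "C_k k f" by (rule C_k_Suc_imp)
qed

lemma smooth_GDERIV: "smooth f \<Longrightarrow> GDERIV f x :> grad f x"
  using C_k_SucD(1) smooth_def by blast

lemma smooth_grad: "smooth f \<Longrightarrow> i \<in> Basis \<Longrightarrow> smooth (\<lambda>x. grad f x \<bullet> i)"
  using C_k_SucD(2) smooth_def by blast

lemma smooth_continuous: "smooth f \<Longrightarrow> continuous_on UNIV f"
  using smooth_def C_k.simps(1) by blast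

lemma smooth_const [simp]: "smooth (\<lambda>x. c)"
  and smooth_add: "smooth f \<Longrightarrow> smooth g \<Longrightarrow> smooth (\<lambda>x. f x + g x)"
  and smooth_mult: "smooth f \<Longrightarrow> smooth g \<Longrightarrow> smooth (\<lambda>x. f x * g x)"
  by (auto simp: smooth_def C_k_const C_k_add C_k_mult)

lemma smooth_compose:
  fixes g :: "real \<Rightarrow> real"
  shows "smooth g \<Longrightarrow> smooth f \<Longrightarrow> smooth (\<lambda>x. g (f x))"
  by (auto simp: smooth_def C_k_compose)

lemma smooth_uminus: "smooth f \<Longrightarrow> smooth (\<lambda>x. - f x)"
  using smooth_mult[OF smooth_const[of "-1"]] by simp

lemma smooth_diff: "smooth f \<Longrightarrow> smooth g \<Longrightarrow> smooth (\<lambda>x. f x - g x)"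
  using smooth_add[OF _ smooth_uminus] by fastforce

lemma smooth_power: "smooth f \<Longrightarrow> smooth (\<lambda>x. f x ^ k)"
  by (induction k) (auto intro: smooth_mult)

lemma smooth_sum: "(\<And>j. j \<in> J \<Longrightarrow> smooth (f j)) \<Longrightarrow> smooth (\<lambda>x. \<Sum>j\<in>J. f j x)"
  by (induction J rule: infinite_finite_induct) (auto intro: smooth_add)

lemma smooth_id [simp]: "smooth (\<lambda>t::real. t)"
  by (rule smoothI_grad[where D="\<lambda>x. 1"]) (auto simp: gderiv_deriv)

lemma GDERIV_linear: "GDERIV (\<lambda>x. (x - y) \<bullet> v) x :> v"
  unfolding gderiv_def by (auto intro!: derivative_eq_intros)

lemma smooth_linear: "smooth (\<lambda>x::'a::euclidean_space. (x - y) \<bullet> v)"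
  by (rule smoothI_grad[OF GDERIV_linear]) simp

lemma GDERIV_dist_sq:
  "GDERIV (\<lambda>x::'a::euclidean_space. (x - y) \<bullet> (x - y)) x :> 2 *\<^sub>R (x - y)"
  unfolding gderiv_def by (auto intro!: derivative_eq_intros simp: inner_commute)

lemma smooth_dist_sq: "smooth (\<lambda>x::'a::euclidean_space. (x - y) \<bullet> (x - y))"
  by (rule smoothI_grad[OF GDERIV_dist_sq])
     (auto simp: inner_scaleR_left intro!: smooth_mult smooth_linear)

lemma smooth_exp: "smooth (exp :: real \<Rightarrow> real)"
  unfolding smooth_def
proof
  fix k show "C_k k (exp :: real \<Rightarrow> real)"
  proof (induction k)
    case (Suc k)
    show ?case by (rule C_k_SucI[where D=exp]) (auto simp: gderiv_deriv Suc.IH)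
  qed (auto intro: continuous_intros)
qed

text \<open>All exponents are treated at once, because differentiation lowers the exponent.\<close>

lemma smooth_powr:
  fixes p :: "'a::euclidean_space \<Rightarrow> real"
  assumes p: "smooth p" and pos: "\<And>x. p x > 0"
  shows "smooth (\<lambda>x. p x powr e)"
proof -
  have "C_k k (\<lambda>x. p x powr e)" for k
  proof (induction k arbitrary: e)
    case 0
    show ?case using smooth_continuous[OF p] pos
      by (auto intro!: continuous_intros) (metis less_irrefl)
  next
    case (Suc k)
    have "GDERIV (\<lambda>x. p x powr e) x :> (e * p x powr (e - 1)) *\<^sub>R grad p x" for x
      by (rule GDERIV_DERIV_compose[OF smooth_GDERIV[OF p] has_real_derivative_powr[OF pos]])
    then show ?case
    proof (rule C_k_SucI)
      show "C_k k (\<lambda>x. ((e * p x powr (e - 1)) *\<^sub>R grad p x) \<bullet> i)" if "i \<in> Basis" for i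
        unfolding inner_scaleR_left using smooth_grad[OF p that]
        by (intro C_k_mult C_k_const Suc.IH) (auto simp: smooth_def)
    qed
  qed
  then show ?thesis by (simp add: smooth_def)
qed

text \<open>For \<open>j = 0\<close> this is the classical function \<open>exp (- 1 / t)\<close> that vanishes to infinite order at \<open>0\<close>.
The factor \<open>(1 / t) ^ j\<close> makes the family closed under differentiation up to linear combinations,
which gives smoothness of all members by induction.\<close>

definition flat :: "nat \<Rightarrow> real \<Rightarrow> real" where
  "flat j t = (if t > 0 then (1 / t) ^ j * exp (- (1 / t)) else 0)"

lemma flat_nonneg: "flat j t \<ge> 0"
  by (simp add: flat_def)

text \<open>One term of the exponential series of \<open>1 / t\<close> is at most its sum.\<close>

lemma flat_le_fact: "flat j t \<le> fact j"
proof (cases "t > 0")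
  case True
  have "(1 / t) ^ j /\<^sub>R fact j \<le> exp (1 / t)"
    using sum_le_suminf[OF summable_exp_generic[of "1 / t"], of "{j}"] True
    by (simp add: exp_def)
  then have "(1 / t) ^ j / fact j \<le> exp (1 / t)"
    by (simp only: real_scaleR_def divide_inverse mult.commute)
  then have "(1 / t) ^ j \<le> fact j * exp (1 / t)"
    by (simp only: pos_divide_le_eq fact_gt_zero mult.commute)
  then have "(1 / t) ^ j * exp (- (1 / t)) \<le> fact j * exp (1 / t) * exp (- (1 / t))"
    by (rule mult_right_mono) simp
  also have "\<dots> = fact j"
    by (simp add: mult.assoc flip: exp_add)
  finally show ?thesis by (simp add: flat_def True)
qed (simp add: flat_def)

lemma flat_eq_0: "t \<le> 0 \<Longrightarrow> flat j t = 0"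
  by (simp add: flat_def)

lemma mult_flat_Suc: "t * flat (Suc j) t = flat j t"
  by (simp add: flat_def)

text \<open>At \<open>0\<close> the difference quotient is \<open>h * flat (j + 2) h\<close>, and the second factor is bounded.\<close>

lemma DERIV_flat: "DERIV (flat j) t :> flat (j + 2) t - real j * flat (j + 1) t"
proof -
  consider "t > 0" | "t < 0" | "t = 0" by linarith
  then show ?thesis
  proof cases
    case 1
    have "DERIV (\<lambda>t. (1 / t) ^ j * exp (- (1 / t))) t :> flat (j + 2) t - real j * flat (j + 1) t"
    proof -
      have inv: "DERIV (\<lambda>t. 1 / t) t :> - (1 / t) * (1 / t)"
        using 1 by (auto intro!: derivative_eq_intros simp: field_simps)
      have "DERIV (\<lambda>t. (1 / t) ^ j * exp (- (1 / t))) t :>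
          real j * (- (1 / t) * (1 / t) * (1 / t) ^ (j - Suc 0)) * exp (- (1 / t)) +
          exp (- (1 / t)) * - (- (1 / t) * (1 / t)) * (1 / t) ^ j"
        by (intro DERIV_mult DERIV_power DERIV_fun_exp DERIV_minus inv)
      moreover have "real j * (- (1 / t) * (1 / t) * (1 / t) ^ (j - Suc 0)) * exp (- (1 / t)) +
          exp (- (1 / t)) * - (- (1 / t) * (1 / t)) * (1 / t) ^ j =
          flat (j + 2) t - real j * flat (j + 1) t"
        using 1 by (cases j) (simp_all add: flat_def algebra_simps)
      ultimately show ?thesis by simp
    qed
    then show ?thesis
      by (rule has_field_derivative_transform_within_open[where S="{0<..}"])
         (use 1 in \<open>auto simp: flat_def\<close>)
  next
    case 2
    have "DERIV (\<lambda>t. 0) t :> flat (j + 2) t - real j * flat (j + 1) t"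
      using 2 by (simp add: flat_def)
    then show ?thesis
      by (rule has_field_derivative_transform_within_open[where S="{..<0}"])
         (use 2 in \<open>auto simp: flat_def\<close>)
  next
    case 3
    have "((\<lambda>h. flat j h / h) \<longlongrightarrow> 0) (at 0)"
    proof (rule Lim_null_comparison)
      have "norm (flat j h / h) \<le> fact (j + 2) * \<bar>h\<bar>" for h
      proof -
        have "flat j h = h * (h * flat (j + 2) h)"
          by (simp add: mult_flat_Suc numeral_2_eq_2)
        then have "norm (flat j h / h) = \<bar>h\<bar> * flat (j + 2) h"
          by (simp add: abs_mult flat_nonneg)
        also have "\<dots> \<le> \<bar>h\<bar> * fact (j + 2)"
          by (intro mult_left_mono flat_le_fact) simp
        finally show ?thesis by (simp add: mult.commute)
      qed
      then show "\<forall>\<^sub>F h in at 0. norm (flat j h / h) \<le> fact (j + 2) * \<bar>h\<bar>" by simp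
      show "((\<lambda>h. fact (j + 2) * \<bar>h\<bar> :: real) \<longlongrightarrow> 0) (at 0)"
        by (auto intro!: tendsto_eq_intros)
    qed
    then show ?thesis
      by (simp add: 3 DERIV_def flat_eq_0)
  qed
qed

lemma smooth_flat: "smooth (flat j)"
proof -
  have "C_k k (flat j)" for k
  proof (induction k arbitrary: j)
    case 0
    show ?case
      using DERIV_isCont[OF DERIV_flat] by (simp add: continuous_on_eq_continuous_at)
  next
    case (Suc k)
    show ?case
    proof (rule C_k_SucI)
      show "GDERIV (flat j) t :> flat (j + 2) t + (- real j) * flat (j + 1) t" for t
        using DERIV_flat[of j t] by simp
      show "C_k k (\<lambda>t. (flat (j + 2) t + (- real j) * flat (j + 1) t) \<bullet> i)" if "i \<in> Basis" for i
        unfolding inner_real_def by (intro C_k_add C_k_mult C_k_const Suc.IH)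
    qed
  qed
  then show ?thesis by (simp add: smooth_def)
qed

section \<open>A compactly supported subsolution for drifts of bounded size\<close>

definition laplacian :: "('a::euclidean_space \<Rightarrow> real) \<Rightarrow> 'a \<Rightarrow> real" where
  "laplacian f x = (\<Sum>i\<in>Basis. grad (\<lambda>x. grad f x \<bullet> i) x \<bullet> i)"

text \<open>Gradients of radial functions are multiples of \<open>x - y\<close>; this gives their Laplacians.\<close>

lemma divergence_multiple_of_position:
  fixes k :: "'a::euclidean_space \<Rightarrow> real"
  assumes k: "GDERIV k x :> D"
  shows "(\<Sum>i\<in>Basis. grad (\<lambda>x. k x * ((x - y) \<bullet> i)) x \<bullet> i) = DIM('a) * k x + D \<bullet> (x - y)"
proof -
  have "grad (\<lambda>x. k x * ((x - y) \<bullet> i)) x \<bullet> i = k x + (D \<bullet> i) * ((x - y) \<bullet> i)"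
    if "i \<in> Basis" for i
    using that by (simp add: GDERIV_imp_grad[OF GDERIV_mult[OF k GDERIV_linear]]
        inner_add_left inner_scaleR_left mult.commute)
  then have "(\<Sum>i\<in>Basis. grad (\<lambda>x. k x * ((x - y) \<bullet> i)) x \<bullet> i) =
      (\<Sum>i\<in>(Basis::'a set). k x) + (\<Sum>i\<in>Basis. (D \<bullet> i) * ((x - y) \<bullet> i))"
    by (simp add: sum.distrib)
  then show ?thesis using euclidean_inner[of D "x - y"] by simp
qed

text \<open>A smooth substitute for the positive part. It has to be convex and increasing, so that composing it
with a subsolution gives a subsolution again: \<open>t * exp (- 1 / t)\<close> has the nonnegative second
derivative \<open>flat 3\<close> on the whole line.\<close>

definition ramp :: "real \<Rightarrow> real" where
  "ramp t = t * flat 0 t"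

lemma smooth_ramp: "smooth ramp"
  unfolding ramp_def by (intro smooth_mult smooth_id smooth_flat)

lemma DERIV_ramp: "DERIV ramp t :> flat 0 t + flat 1 t"
proof -
  have "DERIV ramp t :> t * flat 2 t + flat 0 t"
    unfolding ramp_def using DERIV_flat[of 0 t]
    by (auto intro!: derivative_eq_intros simp: mult.commute numeral_2_eq_2)
  then show ?thesis by (simp add: mult_flat_Suc numeral_2_eq_2 add.commute)
qed

lemma DERIV_ramp': "DERIV (\<lambda>t. flat 0 t + flat 1 t) t :> flat 3 t"
  using DERIV_add[OF DERIV_flat[of 0 t] DERIV_flat[of 1 t]]
  by (simp add: numeral_2_eq_2 numeral_3_eq_3)

lemma ramp_mono: "s \<le> t \<Longrightarrow> ramp s \<le> ramp t"
proof (rule DERIV_nonneg_imp_nondecreasing[of s t ramp])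
  show "\<exists>y. (ramp has_real_derivative y) (at x) \<and> 0 \<le> y" for x
    using DERIV_ramp[of x] flat_nonneg[of 0 x] flat_nonneg[of 1 x] by force
qed

lemma ramp_nonneg: "ramp t \<ge> 0" and ramp_eq_0: "t \<le> 0 \<Longrightarrow> ramp t = 0"
  by (auto simp: ramp_def flat_def)

text \<open>The squared distance \<open>s\<close> to the pole is replaced by \<open>rounded a s\<close>, which agrees with \<open>s\<close> for
\<open>s \<ge> a\<close> but stays comparable to \<open>a\<close> for \<open>0 \<le> s \<le> a\<close>. A radial function that is singular at
\<open>s = 0\<close> thereby becomes smooth while nothing changes outside the ball of radius \<open>sqrt a\<close>.\<close>

definition rounded :: "real \<Rightarrow> real \<Rightarrow> real" where
  "rounded a s = s + a * flat 0 (1 - s / a)"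

definition rounded' :: "real \<Rightarrow> real \<Rightarrow> real" where
  "rounded' a s = 1 - flat 2 (1 - s / a)"

definition rounded'' :: "real \<Rightarrow> real \<Rightarrow> real" where
  "rounded'' a s = (flat 4 (1 - s / a) - 2 * flat 3 (1 - s / a)) / a"

lemma DERIV_rounded:
  assumes "a > 0" shows "DERIV (rounded a) s :> rounded' a s"
proof -
  have lin: "DERIV (\<lambda>s. 1 - s / a) s :> - (1 / a)"
    using assms by (auto intro!: derivative_eq_intros)
  have "DERIV (\<lambda>s. s + a * flat 0 (1 - s / a)) s :> 1 + a * (flat 2 (1 - s / a) * - (1 / a))"
    using DERIV_add[OF DERIV_ident DERIV_cmult[OF DERIV_chain2[OF DERIV_flat[of 0] lin]], of a]
    by (simp add: numeral_2_eq_2)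
  then show ?thesis using assms by (simp add: rounded_def[abs_def] rounded'_def)
qed

lemma DERIV_rounded':
  assumes "a > 0" shows "DERIV (rounded' a) s :> rounded'' a s"
proof -
  have lin: "DERIV (\<lambda>s. 1 - s / a) s :> - (1 / a)"
    using assms by (auto intro!: derivative_eq_intros)
  have "DERIV (\<lambda>s. 1 - flat 2 (1 - s / a)) s :>
      0 - (flat 4 (1 - s / a) - 2 * flat 3 (1 - s / a)) * - (1 / a)"
    using DERIV_diff[OF DERIV_const DERIV_chain2[OF DERIV_flat[of 2] lin], of 1]
    by (simp add: eval_nat_numeral)
  then show ?thesis using assms by (simp add: rounded'_def[abs_def] rounded''_def)
qed

lemma rounded_eq:
  assumes "a > 0" "s \<ge> a"
  shows "rounded a s = s" "rounded' a s = 1" "rounded'' a s = 0"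
  using assms by (auto simp: rounded_def rounded'_def rounded''_def flat_eq_0)

lemma rounded_ge_self: "a > 0 \<Longrightarrow> s \<le> rounded a s"
  by (simp add: rounded_def flat_nonneg)

lemma rounded_ge:
  assumes "a > 0" "s \<ge> 0"
  shows "rounded a s \<ge> exp (- 2) * a"
proof (cases "s \<ge> a / 2")
  case True
  have "exp (- 2) \<le> (1 / 2 :: real)"
    using exp_ge_add_one_self[of 2] by (simp add: exp_minus field_simps)
  then have "exp (- 2) * a \<le> (1 / 2) * a" by (rule mult_right_mono) (use assms in simp)
  then show ?thesis using True rounded_ge_self[OF assms(1), of s] by simp
next
  case False
  define t where "t = 1 - s / a"
  have t: "t \<ge> 1 / 2" using False assms by (simp add: t_def field_simps)
  then have "1 / t \<le> 2" by (simp add: divide_le_eq)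
  then have "exp (- 2) \<le> flat 0 t" using t by (simp add: flat_def)
  then have "exp (- 2) * a \<le> a * flat 0 t" using assms by (simp add: mult.commute)
  moreover have "rounded a s = s + a * flat 0 t" by (simp add: rounded_def t_def)
  ultimately show ?thesis using assms by linarith
qed

lemma rounded_pos: "a > 0 \<Longrightarrow> s \<ge> 0 \<Longrightarrow> rounded a s > 0"
  using rounded_ge[of a s] by (smt (verit) exp_gt_zero mult_pos_pos)

lemma abs_rounded'_le: "\<bar>rounded' a s\<bar> \<le> 3"
  using flat_nonneg[of 2 "1 - s / a"] flat_le_fact[of 2 "1 - s / a"]
  by (simp add: rounded'_def eval_nat_numeral)

lemma abs_rounded''_le: "a > 0 \<Longrightarrow> \<bar>rounded'' a s\<bar> \<le> 36 / a"
  using flat_nonneg[of 3 "1 - s / a"] flat_le_fact[of 3 "1 - s / a"]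
    flat_nonneg[of 4 "1 - s / a"] flat_le_fact[of 4 "1 - s / a"]
  by (simp add: rounded''_def eval_nat_numeral abs_le_iff divide_right_mono flip: minus_divide_left)

text \<open>With \<open>r = sqrt t\<close> this is \<open>r powr (- n) * exp (- K * r)\<close>. A radial \<open>f\<close> with
\<open>f' r = - (r powr (1 - n)) * exp (- K * r)\<close> has \<open>\<Delta> f = K * \<bar>\<nabla> f\<bar>\<close> away from the pole, so that it is
a subsolution for every drift of size at most \<open>K\<close>, with the singularity of the fundamental solution
of the Laplacian. As a function of \<open>t\<close> its derivative is \<open>- kernel n K t / 2\<close>.\<close>

definition kernel :: "real \<Rightarrow> real \<Rightarrow> real \<Rightarrow> real" where
  "kernel n K t = t powr (- n / 2) * exp (- K * t powr (1 / 2))"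

lemma kernel_nonneg: "kernel n K t \<ge> 0"
  by (simp add: kernel_def)

lemma DERIV_kernel:
  assumes "t > 0"
  shows "DERIV (kernel n K) t :> - (n / (2 * t) + K / (2 * sqrt t)) * kernel n K t"
proof -
  have "DERIV (kernel n K) t :>
      (- n / 2 * t powr (- n / 2 - 1)) * exp (- K * t powr (1 / 2)) +
      t powr (- n / 2) * (exp (- K * t powr (1 / 2)) * (- K * (1 / 2 * t powr (1 / 2 - 1))))"
    unfolding kernel_def[abs_def] using assms
    by (auto intro!: derivative_eq_intros)
  also have "t powr (- n / 2 - 1) = t powr (- n / 2) / t"
    using assms by (simp add: powr_diff)
  also have "t powr (1 / 2 - 1) = 1 / sqrt t"
    using assms by (simp add: powr_minus_divide powr_half_sqrt)
  finally show ?thesis using assms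
    by (simp add: kernel_def[abs_def] algebra_simps)
qed

lemma kernel_antiderivative:
  obtains N where "\<And>t. t > 0 \<Longrightarrow> DERIV N t :> - kernel n K t / 2" "N T = 0"
proof -
  have "isCont (\<lambda>t. - kernel n K t / 2) t" if "t > 0" for t
    using DERIV_isCont[OF DERIV_kernel[OF that]] by (intro continuous_intros) auto
  then have "\<exists>F. \<forall>t. ereal 0 < ereal t \<longrightarrow> ereal t < \<infinity> \<longrightarrow>
      (F has_vector_derivative - kernel n K t / 2) (at t)"
    by (intro einterval_antiderivative) auto
  then obtain F where "\<And>t. t > 0 \<Longrightarrow> DERIV F t :> - kernel n K t / 2"
    by (auto simp: has_real_derivative_iff_has_vector_derivative)
  then have "DERIV (\<lambda>t. F t - F T) t :> - kernel n K t / 2" if "t > 0" for t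
    using that by (auto intro!: derivative_eq_intros)
  then show ?thesis using that[of "\<lambda>t. F t - F T"] by auto
qed

text \<open>The gradient of the rounded radial function is \<open>- flux n K a s *\<^sub>R (x - y)\<close>, where
\<open>s\<close> is the squared distance of \<open>x\<close> to \<open>y\<close>.\<close>

definition flux :: "real \<Rightarrow> real \<Rightarrow> real \<Rightarrow> real \<Rightarrow> real" where
  "flux n K a s = kernel n K (rounded a s) * rounded' a s"

definition flux' :: "real \<Rightarrow> real \<Rightarrow> real \<Rightarrow> real \<Rightarrow> real" where
  "flux' n K a s = kernel n K (rounded a s) *
     (rounded'' a s - (n / (2 * rounded a s) + K / (2 * sqrt (rounded a s))) * (rounded' a s)\<^sup>2)"

lemma DERIV_flux:
  assumes "a > 0" "s \<ge> 0"
  shows "DERIV (flux n K a) s :> flux' n K a s"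
  using DERIV_mult[OF DERIV_chain2[OF DERIV_kernel[OF rounded_pos[OF assms]] DERIV_rounded[OF assms(1)]]
      DERIV_rounded'[OF assms(1)], of n K]
  by (simp add: flux_def[abs_def] flux'_def algebra_simps power2_eq_square)

text \<open>The left-hand side of the second identity is the Laplacian of the radial function, the right-hand
side is \<open>K\<close> times the length of its gradient.\<close>

lemma flux_outside:
  assumes "a > 0" "s \<ge> a"
  shows "flux n K a s = kernel n K s"
    and "- n * flux n K a s - 2 * s * flux' n K a s = K * sqrt s * flux n K a s"
proof -
  have "K * (s * k) / sqrt s = K * (sqrt s * k)" for k
  proof -
    have "s / sqrt s = sqrt s" using assms by (simp add: real_div_sqrt)
    moreover have "K * (s * k) / sqrt s = K * (s / sqrt s * k)" by simp
    ultimately show ?thesis by simp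
  qed
  from this[of "kernel n K s"]
  show "- n * flux n K a s - 2 * s * flux' n K a s = K * sqrt s * flux n K a s"
    using assms by (simp add: flux_def flux'_def rounded_eq algebra_simps)
qed (use assms in \<open>simp add: flux_def rounded_eq\<close>)

text \<open>It bounds the failure of the subsolution inequality in the core ball, measured in units of
\<open>a powr (- n / 2)\<close>. What matters is that it depends on the dimension only.\<close>

definition core_const :: "real \<Rightarrow> real" where
  "core_const n = (12 * n + 84) * exp n"

text \<open>By scaling, everything of interest in the core \<open>s < a\<close> is at most a constant multiple of the
kernel at \<open>rounded a s\<close>, hence of \<open>a powr (- n / 2)\<close>. The condition \<open>K * sqrt a \<le> 1\<close> makes the
drift a lower order term at this scale.\<close>

lemma flux_inside:
  assumes a: "a > 0" and s: "0 \<le> s" "s < a" and n: "n \<ge> 0" and K: "0 \<le> K" "K * sqrt a \<le> 1"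
  shows "n * \<bar>flux n K a s\<bar> + 2 * s * \<bar>flux' n K a s\<bar> + K * sqrt s * \<bar>flux n K a s\<bar>
    \<le> core_const n * a powr (- n / 2)"
proof -
  define p where "p = rounded a s"
  define g where "g = kernel n K p"
  have p: "p > 0" "p \<ge> exp (- 2) * a" "s \<le> p"
    using rounded_pos[OF a s(1)] rounded_ge[OF a s(1)] rounded_ge_self[OF a] by (auto simp: p_def)
  have g0: "g \<ge> 0" by (simp add: g_def kernel_nonneg)
  have "g \<le> p powr (- n / 2)"
    using K by (simp add: g_def kernel_def mult_left_le)
  also have "\<dots> \<le> (exp (- 2) * a) powr (- n / 2)"
    using p a n by (intro powr_mono2') auto
  also have "\<dots> = exp n * a powr (- n / 2)"
    using a by (simp add: powr_mult exp_powr_real)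
  finally have g: "g \<le> exp n * a powr (- n / 2)" .
  have r1: "\<bar>rounded' a s\<bar> \<le> 3" by (rule abs_rounded'_le)
  have r1s: "(rounded' a s)\<^sup>2 \<le> 9"
    using power_mono[OF r1, of 2] by simp
  have Ks: "K * sqrt s \<le> 1"
    using mult_left_mono[of "sqrt s" "sqrt a" K] s K by auto
  have fl: "\<bar>flux n K a s\<bar> \<le> g * 3"
    unfolding flux_def p_def[symmetric] g_def[symmetric] abs_mult
    using g0 r1 by (simp add: mult_left_mono)
  have q1: "s * n / p \<le> n" 
    using p n s by (simp add: divide_le_eq mult.commute mult_left_mono)
  have "s / sqrt p \<le> sqrt s"
  proof -
    have "s = sqrt s * sqrt s" using s by simp
    also have "\<dots> \<le> sqrt s * sqrt p" using p s by (intro mult_left_mono) auto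
    finally show ?thesis using p by (simp add: divide_le_eq)
  qed
  then have q2: "s * K / sqrt p \<le> 1"
    using mult_left_mono[of "s / sqrt p" "sqrt s" K] K Ks by (simp add: mult.commute)
  have q3: "s * \<bar>rounded'' a s\<bar> \<le> 36"
  proof -
    have "s * \<bar>rounded'' a s\<bar> \<le> a * (36 / a)"
      using abs_rounded''_le[OF a, of s] s a by (intro mult_mono) auto
    then show ?thesis using a by simp
  qed
  define w where "w = n / (2 * p) + K / (2 * sqrt p)"
  have w0: "w \<ge> 0" using n K p by (simp add: w_def)
  have w: "2 * s * w \<le> n + 1"
  proof -
    have "2 * s * w = s * n / p + s * K / sqrt p" by (simp add: w_def distrib_left)
    then show ?thesis using q1 q2 by linarith
  qed
  have "2 * s * \<bar>flux' n K a s\<bar> = g * (2 * s * \<bar>rounded'' a s - w * (rounded' a s)\<^sup>2\<bar>)"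
    unfolding flux'_def p_def[symmetric] g_def[symmetric] abs_mult w_def using g0 by simp
  also have "\<dots> \<le> g * (72 + 9 * (n + 1))"
  proof (intro mult_left_mono g0)
    have "2 * s * \<bar>rounded'' a s - w * (rounded' a s)\<^sup>2\<bar>
        \<le> 2 * s * (\<bar>rounded'' a s\<bar> + w * (rounded' a s)\<^sup>2)"
      using s w0 by (intro mult_left_mono order_trans[OF abs_triangle_ineq4]) (auto simp: abs_mult)
    also have "\<dots> = 2 * (s * \<bar>rounded'' a s\<bar>) + (2 * s * w) * (rounded' a s)\<^sup>2"
      by (simp add: algebra_simps)
    also have "\<dots> \<le> 2 * 36 + (n + 1) * 9"
      using q3 w r1s s w0 n by (intro add_mono mult_mono) auto
    finally show "2 * s * \<bar>rounded'' a s - w * (rounded' a s)\<^sup>2\<bar> \<le> 72 + 9 * (n + 1)" by simp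
  qed
  finally have 2: "2 * s * \<bar>flux' n K a s\<bar> \<le> g * (72 + 9 * (n + 1))" .
  have 1: "n * \<bar>flux n K a s\<bar> \<le> n * (g * 3)" using fl n by (rule mult_left_mono)
  have 3: "K * sqrt s * \<bar>flux n K a s\<bar> \<le> 1 * (g * 3)"
    using fl Ks by (intro mult_mono) auto
  have "n * \<bar>flux n K a s\<bar> + 2 * s * \<bar>flux' n K a s\<bar> + K * sqrt s * \<bar>flux n K a s\<bar>
      \<le> (12 * n + 84) * g"
    using 1 2 3 by (simp add: algebra_simps)
  also have "\<dots> \<le> (12 * n + 84) * (exp n * a powr (- n / 2))"
    using g n by (intro mult_left_mono) auto
  finally show ?thesis by (simp add: core_const_def)
qed

lemma smooth_flux:
  fixes y :: "'a::euclidean_space"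
  assumes a: "a > 0"
  shows "smooth (\<lambda>x. flux n K a ((x - y) \<bullet> (x - y)))"
proof -
  have lin: "smooth (\<lambda>x. 1 - (1 / a) * ((x - y) \<bullet> (x - y)))"
    by (intro smooth_diff smooth_const smooth_mult smooth_dist_sq)
  have r: "smooth (\<lambda>x. rounded a ((x - y) \<bullet> (x - y)))"
    using smooth_add[OF smooth_dist_sq smooth_mult[OF smooth_const smooth_compose[OF smooth_flat lin]]]
    by (simp add: rounded_def)
  have "smooth (\<lambda>x. rounded' a ((x - y) \<bullet> (x - y)))"
    using smooth_diff[OF smooth_const smooth_compose[OF smooth_flat lin]]
    by (simp add: rounded'_def)
  then show ?thesis
    unfolding flux_def kernel_def
    by (intro smooth_mult smooth_powr r smooth_const rounded_pos a
        smooth_compose[OF smooth_exp]) auto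
qed

text \<open>The barrier is \<open>ramp\<close> of the rounded radial subsolution, shifted so as to vanish at distance \<open>R\<close>.
The subsolution inequality fails only in the core ball of radius \<open>sqrt a\<close>, and the integral of the
defect \<open>a powr (- n / 2)\<close> over that ball does not depend on \<open>a\<close>: as \<open>a\<close> tends to \<open>0\<close> the defect
behaves like a bounded multiple of a point mass at \<open>y\<close>. The lower bound at \<open>z\<close> does not depend on
\<open>a\<close> either and is of the order of the fundamental solution.\<close>

lemma barrier_exists:
  fixes y :: "'a::euclidean_space"
  defines "n \<equiv> real DIM('a)"
  assumes K: "K > 0" and R: "R > 0" and a: "0 < a" "a \<le> R\<^sup>2" "K * sqrt a \<le> 1"
  obtains \<psi> where
    "smooth \<psi>" "\<And>x. \<psi> x \<ge> 0" "\<And>x. norm (x - y) \<ge> R \<Longrightarrow> \<psi> x = 0"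
    "\<And>x V. norm V \<le> K \<Longrightarrow> laplacian \<psi> x + V \<bullet> grad \<psi> x \<ge>
       - (2 * core_const n * a powr (- n / 2)) * indicator (ball y (sqrt a)) x"
    "\<And>z. a \<le> (norm (z - y))\<^sup>2 \<Longrightarrow> norm (z - y) \<le> 2 / 3 * R \<Longrightarrow>
       \<psi> z \<ge> ramp (5 / 8 * (norm (z - y))\<^sup>2 * (2 / (3 * norm (z - y))) ^ DIM('a) * exp (- K * R))"
proof -
  obtain N where N: "\<And>t. t > 0 \<Longrightarrow> DERIV N t :> - kernel n K t / 2" and NR: "N (R\<^sup>2) = 0"
    using kernel_antiderivative[of n K] by blast
  define s where "s x = (x - y) \<bullet> (x - y)" for x
  define f where "f x = N (rounded a (s x))" for x
  define \<psi> where "\<psi> x = ramp (f x)" for x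
  have s0: "s x \<ge> 0" and s_norm: "s x = (norm (x - y))\<^sup>2" and sqrt_s: "sqrt (s x) = norm (x - y)" for x
    by (simp_all add: s_def power2_norm_eq_inner norm_eq_sqrt_inner)
  have dist_y: "dist y x = sqrt (s x)" for x
    unfolding sqrt_s dist_norm by (rule norm_minus_commute)
  have Ds: "GDERIV s x :> 2 *\<^sub>R (x - y)" for x
    unfolding s_def[abs_def] by (rule GDERIV_dist_sq)
  have sm_flux: "smooth (\<lambda>x. flux n K a (s x))"
    unfolding s_def by (rule smooth_flux[OF a(1)])
  have Dflux: "GDERIV (\<lambda>x. flux n K a (s x)) x :> (2 * flux' n K a (s x)) *\<^sub>R (x - y)" for x
    using GDERIV_DERIV_compose[OF Ds DERIV_flux[OF a(1) s0]] by (simp add: mult.commute)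
  have Df: "GDERIV f x :> - flux n K a (s x) *\<^sub>R (x - y)" for x
  proof -
    have "GDERIV f x :> (- kernel n K (rounded a (s x)) / 2 * rounded' a (s x)) *\<^sub>R 2 *\<^sub>R (x - y)"
      unfolding f_def[abs_def]
      by (rule GDERIV_DERIV_compose[OF Ds DERIV_chain2[OF N[OF rounded_pos[OF a(1) s0]]
                DERIV_rounded[OF a(1)]]])
    then show ?thesis by (simp add: flux_def)
  qed
  have sm_f: "smooth f"
    by (rule smoothI_grad[OF Df])
      (auto simp: inner_scaleR_left intro!: smooth_uminus smooth_mult sm_flux smooth_linear)
  define r1 where "r1 x = flat 0 (f x) + flat 1 (f x)" for x
  have r1: "0 \<le> r1 x" "r1 x \<le> 2" for x
    using flat_nonneg[of 0 "f x"] flat_nonneg[of 1 "f x"]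
      flat_le_fact[of 0 "f x"] flat_le_fact[of 1 "f x"] by (auto simp: r1_def)
  have Dr1: "GDERIV r1 x :> flat 3 (f x) *\<^sub>R - flux n K a (s x) *\<^sub>R (x - y)" for x
    unfolding r1_def[abs_def] by (rule GDERIV_DERIV_compose[OF Df DERIV_ramp'])
  define k where "k x = - (r1 x * flux n K a (s x))" for x
  have grad_\<psi>: "grad \<psi> x = k x *\<^sub>R (x - y)" for x
    using GDERIV_imp_grad[OF GDERIV_DERIV_compose[OF Df DERIV_ramp]]
    unfolding \<psi>_def[abs_def] k_def r1_def by simp
  have Dk: "GDERIV k x :> (flat 3 (f x) * (flux n K a (s x))\<^sup>2 - 2 * r1 x * flux' n K a (s x)) *\<^sub>R (x - y)"
    for x
    using GDERIV_minus[OF GDERIV_mult[OF Dr1 Dflux]] unfolding k_def[abs_def]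
    by (rule GDERIV_subst) (simp add: algebra_simps power2_eq_square flip: scaleR_add_left)
  have lap: "laplacian \<psi> x = n * k x + (flat 3 (f x) * (flux n K a (s x))\<^sup>2 - 2 * r1 x * flux' n K a (s x)) * s x"
    for x
  proof -
    have "laplacian \<psi> x = (\<Sum>i\<in>Basis. grad (\<lambda>x. k x * ((x - y) \<bullet> i)) x \<bullet> i)"
      unfolding laplacian_def grad_\<psi> inner_scaleR_left ..
    also have "\<dots> = n * k x +
        ((flat 3 (f x) * (flux n K a (s x))\<^sup>2 - 2 * r1 x * flux' n K a (s x)) *\<^sub>R (x - y)) \<bullet> (x - y)"
      unfolding n_def by (rule divergence_multiple_of_position[OF Dk[unfolded n_def]])
    finally show ?thesis by (simp only: inner_scaleR_left s_def)
  qed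
  have ineq: "laplacian \<psi> x + V \<bullet> grad \<psi> x \<ge>
       - (2 * core_const n * a powr (- n / 2)) * indicator (ball y (sqrt a)) x"
    if V: "norm V \<le> K" for x V
  proof -
    let ?F = "flux n K a (s x)" and ?F' = "flux' n K a (s x)"
    have "\<bar>V \<bullet> (x - y)\<bar> \<le> K * sqrt (s x)"
      using Cauchy_Schwarz_ineq2[of V "x - y"] mult_right_mono[OF V norm_ge_zero[of "x - y"]]
      by (simp add: sqrt_s)
    then have "\<bar>?F * (V \<bullet> (x - y))\<bar> \<le> \<bar>?F\<bar> * (K * sqrt (s x))"
      unfolding abs_mult by (rule mult_left_mono) simp
    then have b: "?F * (V \<bullet> (x - y)) \<le> K * sqrt (s x) * \<bar>?F\<bar>"
      by (simp only: abs_le_iff mult_ac)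
    have "r1 x * (- n * ?F - 2 * s x * ?F' - K * sqrt (s x) * \<bar>?F\<bar>)
        \<le> r1 x * (- n * ?F - 2 * s x * ?F' - ?F * (V \<bullet> (x - y)))"
      using b r1(1)[of x] by (intro mult_left_mono) linarith+
    moreover have "flat 3 (f x) * ?F\<^sup>2 * s x \<ge> 0"
      using s0[of x] flat_nonneg[of 3 "f x"] by simp
    moreover have "laplacian \<psi> x + V \<bullet> grad \<psi> x =
        flat 3 (f x) * ?F\<^sup>2 * s x + r1 x * (- n * ?F - 2 * s x * ?F' - ?F * (V \<bullet> (x - y)))"
      unfolding lap grad_\<psi> k_def inner_scaleR_right by (simp add: algebra_simps)
    ultimately have main: "laplacian \<psi> x + V \<bullet> grad \<psi> x \<ge>
        r1 x * (- n * ?F - 2 * s x * ?F' - K * sqrt (s x) * \<bar>?F\<bar>)" by linarith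
    show ?thesis
    proof (cases "s x \<ge> a")
      case True
      have "?F \<ge> 0" using flux_outside(1)[OF a(1) True] by (simp add: kernel_nonneg)
      then have "- n * ?F - 2 * s x * ?F' - K * sqrt (s x) * \<bar>?F\<bar> = 0"
        using flux_outside(2)[OF a(1) True, of n K] by simp
      moreover have "x \<notin> ball y (sqrt a)"
        using True by (simp add: dist_y)
      ultimately show ?thesis using main by simp
    next
      case False
      let ?E = "core_const n * a powr (- n / 2)"
      have E: "n * \<bar>?F\<bar> + 2 * s x * \<bar>?F'\<bar> + K * sqrt (s x) * \<bar>?F\<bar> \<le> ?E"
        using flux_inside[OF a(1) s0, of x n K] False K a by (simp add: n_def)
      have "\<bar>s x * ?F'\<bar> = s x * \<bar>?F'\<bar>" "\<bar>n * ?F\<bar> = n * \<bar>?F\<bar>"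
        using s0[of x] by (simp_all add: abs_mult n_def)
      then have "- n * ?F - 2 * s x * ?F' - K * sqrt (s x) * \<bar>?F\<bar> \<ge> - ?E"
        using E by linarith
      then have "r1 x * (- n * ?F - 2 * s x * ?F' - K * sqrt (s x) * \<bar>?F\<bar>) \<ge> r1 x * - ?E"
        using r1 by (intro mult_left_mono) auto
      moreover have "r1 x * ?E \<le> 2 * ?E"
        using r1 by (intro mult_right_mono) (auto simp: core_const_def n_def)
      moreover have "x \<in> ball y (sqrt a)"
        using False by (simp add: dist_y)
      ultimately show ?thesis using main by simp
    qed
  qed
  have N_anti: "N t \<le> N t'" if "0 < t'" "t' \<le> t" for t t'
  proof (rule DERIV_nonpos_imp_nonincreasing[OF that(2)])
    show "\<exists>y. DERIV N x :> y \<and> y \<le> 0" if "t' \<le> x" for x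
      using \<open>0 < t'\<close> that kernel_nonneg[of n K x]
      by (intro exI[of _ "- kernel n K x / 2"] conjI N) linarith+
  qed
  have out: "\<psi> x = 0" if "norm (x - y) \<ge> R" for x
  proof -
    have "s x \<ge> R\<^sup>2" using that R by (simp add: s_norm power_mono)
    then have "f x \<le> 0"
      using N_anti[of "R\<^sup>2" "s x"] NR R a by (simp add: f_def rounded_eq)
    then show ?thesis by (simp add: \<psi>_def ramp_eq_0)
  qed
  have lower: "\<psi> z \<ge> ramp (5 / 8 * (norm (z - y))\<^sup>2 * (2 / (3 * norm (z - y))) ^ DIM('a) * exp (- K * R))"
    if az: "a \<le> (norm (z - y))\<^sup>2" and zR: "norm (z - y) \<le> 2 / 3 * R" for z
    unfolding \<psi>_def
  proof (rule ramp_mono)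
    define q where "q = norm (z - y)"
    have q: "q > 0" using az a(1) by (cases "q = 0") (auto simp: q_def)
    \<comment> \<open>The radius \<open>3 / 2 * q\<close> is at most \<open>R\<close>, and between \<open>q\<close> and this radius the function drops by an amount of the right order.\<close>
    have "\<exists>t>q\<^sup>2. t < (3 / 2 * q)\<^sup>2 \<and> N ((3 / 2 * q)\<^sup>2) - N (q\<^sup>2) = ((3 / 2 * q)\<^sup>2 - q\<^sup>2) * (- kernel n K t / 2)"
    proof (rule MVT2)
      show "q\<^sup>2 < (3 / 2 * q)\<^sup>2" using q by (simp add: power2_eq_square)
      show "DERIV N x :> - kernel n K x / 2" if "q\<^sup>2 \<le> x" for x
        using that zero_less_power[OF q, of 2] by (intro N) linarith
    qed
    then obtain t where t: "q\<^sup>2 < t" "t < (3 / 2 * q)\<^sup>2"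
      and eq: "N ((3 / 2 * q)\<^sup>2) - N (q\<^sup>2) = ((3 / 2 * q)\<^sup>2 - q\<^sup>2) * (- kernel n K t / 2)" by blast
    have t0: "t > 0" using t(1) zero_less_power[OF q, of 2] by linarith
    have sqt: "sqrt t \<le> 3 / 2 * q"
      using real_sqrt_le_mono[OF less_imp_le[OF t(2)]] q by simp
    have powr_neg: "inverse w ^ d = w powr (- real d)" if "w > 0" for w :: real and d
      using that by (simp add: power_inverse powr_minus powr_realpow)
    have "2 / (3 * q) = inverse (3 / 2 * q)"
      using q by (simp add: field_simps)
    then have "(2 / (3 * q)) ^ DIM('a) = (3 / 2 * q) powr (- real DIM('a))"
      using powr_neg[of "3 / 2 * q"] q by simp
    also have "\<dots> \<le> sqrt t powr (- real DIM('a))"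
      using sqt t0 by (intro powr_mono2') auto
    also have "\<dots> = t powr (- n / 2)"
    proof -
      have "sqrt t = t powr (1 / 2)" using t0 by (simp add: powr_half_sqrt)
      then show ?thesis by (simp add: powr_powr n_def)
    qed
    finally have k1: "(2 / (3 * q)) ^ DIM('a) \<le> t powr (- n / 2)" .
    have "K * sqrt t \<le> K * R" using sqt zR K by (intro mult_left_mono) (auto simp: q_def)
    then have "exp (- K * R) \<le> exp (- K * t powr (1 / 2))"
      using t0 by (simp add: powr_half_sqrt)
    with k1 have ker: "(2 / (3 * q)) ^ DIM('a) * exp (- K * R) \<le> kernel n K t"
      unfolding kernel_def by (intro mult_mono) auto
    have "5 / 8 * q\<^sup>2 * (2 / (3 * q)) ^ DIM('a) * exp (- K * R) = 5 / 8 * q\<^sup>2 * ((2 / (3 * q)) ^ DIM('a) * exp (- K * R))"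
      by simp
    also have "\<dots> \<le> 5 / 8 * q\<^sup>2 * kernel n K t"
      using ker by (intro mult_left_mono) auto
    also have "\<dots> = N (q\<^sup>2) - N ((3 / 2 * q)\<^sup>2)"
      using eq by (simp add: power2_eq_square algebra_simps)
    also have "\<dots> \<le> N (q\<^sup>2)"
    proof -
      have "(3 / 2 * q)\<^sup>2 \<le> R\<^sup>2"
        using zR q by (intro power_mono) (auto simp: q_def)
      then show ?thesis using N_anti[of "(3 / 2 * q)\<^sup>2" "R\<^sup>2"] NR q by simp
    qed
    also have "\<dots> = f z"
      using az a(1) by (simp add: f_def s_norm rounded_eq q_def)
    finally show "5 / 8 * (norm (z - y))\<^sup>2 * (2 / (3 * norm (z - y))) ^ DIM('a) * exp (- K * R) \<le> f z"
      by (simp add: q_def)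
  qed
  have smooth: "smooth \<psi>" unfolding \<psi>_def[abs_def] by (rule smooth_compose[OF smooth_ramp sm_f])
  have nonneg: "\<psi> x \<ge> 0" for x by (simp add: \<psi>_def ramp_nonneg)
  show ?thesis by (rule that[OF smooth nonneg out ineq lower])
qed

section \<open>The drift as a limit of gradients\<close>

text \<open>The two cases of the drift fit together continuously at \<open>norm x = 1 - 1 / m\<close>; only the direction
\<open>sgn x\<close> is discontinuous, at the origin.\<close>

lemma drift_eq:
  assumes "m > 0"
  shows "drift C m x = - (C / max (1 - norm x) (1 / real m)) *\<^sub>R sgn x"
proof (cases "norm x \<le> 1 - 1 / real m")
  case True
  then have "max (1 - norm x) (1 / real m) = 1 - norm x" by simp
  then show ?thesis using True by (simp add: drift_def)
next
  case False
  then have "max (1 - norm x) (1 / real m) = 1 / real m" by simp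
  then show ?thesis using False by (simp add: drift_def)
qed

lemma norm_drift_le:
  assumes "m > 0" "C \<ge> 0"
  shows "norm (drift C m x) \<le> C * real m"
proof -
  have "C / max (1 - norm x) (1 / real m) \<le> C / (1 / real m)"
    using assms by (intro divide_left_mono) (auto simp: less_max_iff_disj)
  moreover have "max (1 - norm x) (1 / real m) > 0"
    using assms by (simp add: less_max_iff_disj)
  ultimately show ?thesis
    using assms by (simp add: drift_eq norm_sgn)
qed

lemma drift_measurable:
  assumes "m > 0"
  shows "(drift C m :: 'a::euclidean_space \<Rightarrow> 'a) \<in> borel_measurable borel"
proof -
  have "(\<lambda>x::'a. - (C / max (1 - norm x) (1 / real m)) *\<^sub>R (inverse (norm x) *\<^sub>R x)) \<in> borel_measurable borel"
    by measurable
  then show ?thesis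
    by (rule measurable_cong[THEN iffD1, rotated]) (simp add: drift_eq[OF assms] sgn_div_norm)
qed

text \<open>The drift is \<open>- \<nabla> W\<close> for a radial \<open>W\<close> that is not smooth at the origin and on the sphere of radius
\<open>1 - 1 / m\<close>. A function \<open>P (x \<bullet> x)\<close> with a polynomial \<open>P\<close> is smooth and has gradient
\<open>2 * P' (x \<bullet> x) *\<^sub>R x\<close>, so it suffices to choose \<open>P'\<close> by the Weierstrass theorem. The gradient
bound is uniform in \<open>m\<close>, which is what makes the final constant independent of \<open>m\<close>.\<close>

lemma drift_potential:
  assumes C: "C \<ge> 1" and m: "m > 0"
  obtains W :: "nat \<Rightarrow> 'a::euclidean_space \<Rightarrow> real" where
    "\<And>k. smooth (W k)"
    "\<And>k x. norm x < 1 \<Longrightarrow> norm (grad (W k) x) \<le> 3 * C / (1 - norm x)"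
    "\<And>x. norm x < 1 \<Longrightarrow> (\<lambda>k. grad (W k) x) \<longlonglongrightarrow> - drift C m x"
proof -
  define b where "b r = C / max (1 - r) (1 / real m)" for r
  \<comment> \<open>The summand \<open>1 / Suc k\<close> removes the singularity of \<open>b (sqrt s) / (2 * sqrt s)\<close> at \<open>s = 0\<close>, so that the function can be approximated uniformly.\<close>
  define q where "q k s = b (sqrt s) / (2 * sqrt (s + 1 / real (Suc k)))" for k s
  have max_pos: "max (1 - r) (1 / real m) > 0" for r using m by (simp add: less_max_iff_disj)
  have b0: "b r \<ge> 0" for r using C max_pos[of r] by (simp add: b_def)
  have q_cont: "continuous_on {0..1} (q k)" for k
  proof -
    have "sqrt (s + 1 / real (Suc k)) \<noteq> 0" if "s \<ge> 0" for s
    proof -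
      have "s + 1 / real (Suc k) > 0" using that by (intro add_nonneg_pos) auto
      then show ?thesis by (simp del: of_nat_Suc)
    qed
    moreover have "max (1 - r) (1 / real m) \<noteq> 0" for r using max_pos[of r] by simp
    ultimately show ?thesis
      unfolding q_def b_def by (intro continuous_intros ballI) (auto simp del: of_nat_Suc)
  qed
  have "\<exists>a N. \<forall>s\<in>{0..1}. \<bar>q k s - (\<Sum>i\<le>N. a i * s ^ i)\<bar> < 1 / real (Suc k)" for k
  proof -
    obtain p where "real_polynomial_function p" "\<And>s. s \<in> {0..1} \<Longrightarrow> \<bar>q k s - p s\<bar> < 1 / real (Suc k)"
      using Stone_Weierstrass_real_polynomial_function[OF compact_Icc q_cont, of "1 / real (Suc k)" k]
      by (metis divide_pos_pos of_nat_0_less_iff zero_less_Suc zero_less_one)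
    moreover then obtain a N where "p = (\<lambda>x. \<Sum>i\<le>N. a i * x ^ i)"
      unfolding real_polynomial_function_iff_sum by blast
    ultimately show ?thesis by blast
  qed
  then obtain a N where approx:
    "\<And>k s. s \<in> {0..1} \<Longrightarrow> \<bar>q k s - (\<Sum>i\<le>N k. a k i * s ^ i)\<bar> < 1 / real (Suc k)"
    by metis
  define p where "p k s = (\<Sum>i\<le>N k. a k i * s ^ i)" for k s
  define P where "P k s = (\<Sum>i\<le>N k. a k i / real (Suc i) * s ^ Suc i)" for k s
  have DP: "DERIV (P k) s :> p k s" for k s
  proof -
    have "DERIV (\<lambda>s. a k i / real (Suc i) * s ^ Suc i) s :> a k i * s ^ i" for i
      using DERIV_cmult[OF DERIV_pow[of "Suc i" s], of "a k i / real (Suc i)"]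
      by (simp del: power_Suc of_nat_Suc)
    then show ?thesis unfolding P_def[abs_def] p_def by (intro DERIV_sum)
  qed
  define W :: "nat \<Rightarrow> 'a \<Rightarrow> real" where "W k x = P k ((x - 0) \<bullet> (x - 0))" for k x
  have "GDERIV (W k) x :> p k (x \<bullet> x) *\<^sub>R 2 *\<^sub>R x" for k x
    using GDERIV_DERIV_compose[OF GDERIV_dist_sq[of 0 x] DP[of k]]
    unfolding W_def[abs_def] by simp
  then have grad_W: "grad (W k) x = (2 * p k (x \<bullet> x)) *\<^sub>R x" for k x
    by (simp add: GDERIV_imp_grad mult.commute)
  have "smooth (W k)" for k
    unfolding W_def[abs_def] P_def
    by (intro smooth_sum smooth_mult smooth_const smooth_power smooth_dist_sq)
  moreover have "norm (grad (W k) x) \<le> 3 * C / (1 - norm x)" if x: "norm x < 1" for k x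
  proof -
    define r where "r = norm x"
    have r: "0 \<le> r" "r < 1" "x \<bullet> x = r\<^sup>2" using x by (auto simp: r_def power2_norm_eq_inner)
    have pq: "\<bar>p k (r\<^sup>2)\<bar> \<le> q k (r\<^sup>2) + 1"
    proof -
      have "r\<^sup>2 \<in> {0..1}" using r by (simp add: power_le_one)
      from approx[OF this, of k] have "\<bar>p k (r\<^sup>2)\<bar> < \<bar>q k (r\<^sup>2)\<bar> + 1 / real (Suc k)" unfolding p_def by linarith
      moreover have "q k (r\<^sup>2) \<ge> 0" using b0 by (simp add: q_def)
      moreover have "1 / real (Suc k) \<le> 1" by simp
      ultimately show ?thesis by linarith
    qed
    have "2 * r * q k (r\<^sup>2) = b r * (r / sqrt (r\<^sup>2 + 1 / real (Suc k)))"
      using r by (simp add: q_def)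
    also have "\<dots> \<le> b r * 1"
    proof (intro mult_left_mono b0)
      have "r \<le> sqrt (r\<^sup>2 + 1 / real (Suc k))" by (intro real_le_rsqrt) simp
      moreover have "0 < sqrt (r\<^sup>2 + 1 / real (Suc k))"
        by (intro iffD2[OF real_sqrt_gt_0_iff] add_nonneg_pos) auto
      ultimately show "r / sqrt (r\<^sup>2 + 1 / real (Suc k)) \<le> 1"
        by (simp only: divide_le_eq_1_pos)
    qed
    also have "b r * 1 \<le> C / (1 - r)"
      unfolding b_def using C r max_pos[of r] by (simp add: divide_left_mono)
    finally have bound: "2 * r * q k (r\<^sup>2) \<le> C / (1 - r)" .
    have "1 \<le> C / (1 - r)" using C r by (simp add: le_divide_eq)
    have "norm (grad (W k) x) = 2 * r * \<bar>p k (r\<^sup>2)\<bar>"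
      using r by (simp add: grad_W abs_mult r_def[symmetric])
    also have "\<dots> \<le> 2 * r * (q k (r\<^sup>2) + 1)"
      using pq r by (intro mult_left_mono) auto
    also have "\<dots> \<le> C / (1 - r) + 2"
      using bound r by (simp add: distrib_left)
    also have "\<dots> \<le> 3 * (C / (1 - r))"
      using \<open>1 \<le> C / (1 - r)\<close> by linarith
    finally show ?thesis by (simp add: r_def)
  qed
  moreover have "(\<lambda>k. grad (W k) x) \<longlonglongrightarrow> - drift C m x" if x: "norm x < 1" for x
  proof (cases "x = 0")
    case True
    then show ?thesis by (simp add: grad_W drift_eq[OF m])
  next
    case False
    define r where "r = norm x"
    have r: "0 < r" "r < 1" "x \<bullet> x = r\<^sup>2" using x False by (auto simp: r_def power2_norm_eq_inner)
    have r1: "r\<^sup>2 \<in> {0..1}" using r by (simp add: power_le_one)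
    have lim0: "(\<lambda>k. 1 / real (Suc k)) \<longlonglongrightarrow> 0"
      using LIMSEQ_inverse_real_of_nat by (simp only: inverse_eq_divide)
    have "(\<lambda>k. b r / (2 * sqrt (r\<^sup>2 + 1 / real (Suc k)))) \<longlonglongrightarrow> b r / (2 * sqrt (r\<^sup>2 + 0))"
      using r by (intro tendsto_intros lim0) auto
    moreover have "sqrt (r\<^sup>2) = r" using r by simp
    ultimately have q_lim: "(\<lambda>k. q k (r\<^sup>2)) \<longlonglongrightarrow> b r / (2 * r)"
      by (simp only: q_def add_0_right)
    have "(\<lambda>k. p k (r\<^sup>2) - q k (r\<^sup>2)) \<longlonglongrightarrow> 0"
    proof (rule Lim_null_comparison[OF _ lim0])
      show "\<forall>\<^sub>F k in sequentially. norm (p k (r\<^sup>2) - q k (r\<^sup>2)) \<le> 1 / real (Suc k)"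
        using approx[OF r1] unfolding real_norm_def p_def
        by (intro always_eventually allI) (metis abs_minus_commute less_imp_le)
    qed
    from tendsto_add[OF this q_lim] have "(\<lambda>k. p k (r\<^sup>2)) \<longlonglongrightarrow> b r / (2 * r)" by simp
    then have "(\<lambda>k. (2 * p k (r\<^sup>2)) *\<^sub>R x) \<longlonglongrightarrow> (2 * (b r / (2 * r))) *\<^sub>R x"
      by (rule tendsto_scaleR[OF tendsto_mult[OF tendsto_const] tendsto_const])
    moreover have "(2 * (b r / (2 * r))) *\<^sub>R x = - drift C m x"
    proof -
      have "2 * (b r / (2 * r)) = b r * inverse r" using r by (simp add: field_simps)
      moreover have "- drift C m x = (b r * inverse r) *\<^sub>R x"
        unfolding drift_eq[OF m] sgn_div_norm b_def r_def by simp
      ultimately show ?thesis by (simp only:)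
    qed
    ultimately show ?thesis
      by (simp only: grad_W r(3))
  qed
  ultimately show ?thesis by (rule that)
qed

section \<open>The equation tested with an exponentially weighted function\<close>

lemma grad_eq_0_outside:
  assumes "closed K" "\<And>x. x \<notin> K \<Longrightarrow> f x = 0" "x \<notin> K"
  shows "grad f x = (0::'a::euclidean_space)"
proof -
  have "((\<lambda>x. 0) has_derivative (\<lambda>h. 0)) (at x)" by simp
  then have "(f has_derivative (\<lambda>h. 0)) (at x)"
    by (rule has_derivative_transform_within_open[where s="- K"]) (use assms in auto)
  then have "GDERIV f x :> 0" by (simp add: gderiv_def)
  then show ?thesis by (rule GDERIV_imp_grad)
qed

lemma test_functionsI:
  assumes "smooth f" "compact K" "K \<subseteq> S" "\<And>x. x \<notin> K \<Longrightarrow> f x = 0"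
  shows "f \<in> test_functions S"
proof -
  have sub: "closure {x. f x \<noteq> 0} \<subseteq> K"
    using assms(2,4) by (intro closure_minimal compact_imp_closed) auto
  then have "compact (closure {x. f x \<noteq> 0})"
    using assms(2) by (metis closed_Int_compact closed_closure inf.absorb1)
  then show ?thesis
    using sub assms(1,3) by (auto simp: test_functions_def smooth_def)
qed

text \<open>A weak gradient is only known to be locally integrable, so integrability on \<open>S\<close> comes from the
compact support of the other factor.\<close>

lemma integrable_inner_compact_support:
  fixes f g :: "'a::euclidean_space \<Rightarrow> 'b::euclidean_space"
  assumes f: "locally_integrable_on f S" and S: "S \<in> sets lebesgue" and K: "compact K" "K \<subseteq> S"
    and g: "g \<in> borel_measurable borel"
    and bound: "\<And>x. x \<in> K \<Longrightarrow> norm (g x) \<le> B" and zero: "\<And>x. x \<notin> K \<Longrightarrow> g x = 0"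
  shows "integrable (lebesgue_on S) (\<lambda>x. f x \<bullet> g x)"
proof -
  have Kl: "K \<in> sets lebesgue" using K(1) by (simp add: compact_imp_closed)
  have "integrable (lebesgue_on K) f" using f K by (simp add: locally_integrable_on_def)
  then have fK: "integrable lebesgue (\<lambda>x. indicator K x *\<^sub>R f x)"
    using Kl by (simp add: integrable_restrict_space set_integrable_def)
  have gl: "g \<in> borel_measurable lebesgue"
    using g by (intro measurable_completion) simp
  have "integrable lebesgue (\<lambda>x. (indicator K x *\<^sub>R f x) \<bullet> g x)"
  proof (rule Bochner_Integration.integrable_bound)
    show "integrable lebesgue (\<lambda>x. norm (indicator K x *\<^sub>R f x) * B)"
      by (intro integrable_mult_left integrable_norm fK)
    show "(\<lambda>x. (indicator K x *\<^sub>R f x) \<bullet> g x) \<in> borel_measurable lebesgue"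
      using borel_measurable_integrable[OF fK] gl by (rule borel_measurable_inner)
    show "AE x in lebesgue. norm ((indicator K x *\<^sub>R f x) \<bullet> g x) \<le> norm (norm (indicator K x *\<^sub>R f x) * B)"
    proof (intro AE_I2)
      fix x
      show "norm ((indicator K x *\<^sub>R f x) \<bullet> g x) \<le> norm (norm (indicator K x *\<^sub>R f x) * B)"
      proof (cases "x \<in> K")
        case True
        have "\<bar>f x \<bullet> g x\<bar> \<le> norm (f x) * norm (g x)" by (rule Cauchy_Schwarz_ineq2)
        also have "\<dots> \<le> norm (f x) * \<bar>B\<bar>" using bound[OF True] by (intro mult_left_mono) auto
        finally show ?thesis using True by (simp add: abs_mult)
      qed simp
    qed
  qed
  also have "(\<lambda>x. (indicator K x *\<^sub>R f x) \<bullet> g x) = (\<lambda>x. indicator S x *\<^sub>R (f x \<bullet> g x))"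
    using zero K(2) by (auto simp: indicator_def fun_eq_iff)
  finally show ?thesis
    using S by (simp add: integrable_restrict_space set_integrable_def)
qed

lemma integrable_mult_compact_support:
  fixes f g :: "'a::euclidean_space \<Rightarrow> real"
  assumes f: "locally_integrable_on f S" and S: "S \<in> sets lebesgue" and K: "compact K" "K \<subseteq> S"
    and g: "continuous_on UNIV g" and zero: "\<And>x. x \<notin> K \<Longrightarrow> g x = 0"
  shows "integrable (lebesgue_on S) (\<lambda>x. f x * g x)"
proof -
  obtain B where "\<And>x. x \<in> K \<Longrightarrow> norm (g x) \<le> B"
    using compact_imp_bounded[OF compact_continuous_image[OF continuous_on_subset[OF g subset_UNIV] K(1)]]
    by (auto simp: bounded_iff)
  then show ?thesis
    by (rule integrable_inner_compact_support[OF f S K borel_measurable_continuous_onI[OF g] _ zero,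
          unfolded inner_real_def])
qed

lemma continuous_grad:
  assumes "smooth f"
  shows "continuous_on UNIV (grad f)"
proof -
  have "continuous_on UNIV (\<lambda>x. \<Sum>i\<in>Basis. (grad f x \<bullet> i) *\<^sub>R i)"
    by (intro continuous_on_sum continuous_on_scaleR continuous_on_const
        smooth_continuous[OF smooth_grad[OF assms]])
  then show ?thesis by (simp add: euclidean_representation)
qed

text \<open>For \<open>b = - \<nabla> W\<close> one has \<open>- \<Delta> u + b \<bullet> \<nabla> u = - exp (- W) * div (exp W *\<^sub>R \<nabla> u)\<close>. Testing with
\<open>exp W * \<psi>\<close> therefore produces \<open>exp W * (\<nabla> u \<bullet> \<nabla> \<psi>)\<close>, and a further integration by parts moves
all derivatives to \<open>\<psi>\<close>, where they form the operator \<open>\<Delta> \<psi> + \<nabla> W \<bullet> \<nabla> \<psi>\<close> without a zeroth order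
term. In general the mismatch \<open>\<nabla> W + b\<close> appears in an error term.\<close>

lemma weighted_weak_form:
  fixes u :: "'a::euclidean_space \<Rightarrow> real"
  assumes wg: "is_weak_gradient S u Du" and S: "S \<in> sets lebesgue" and K: "compact K" "K \<subseteq> S"
    and W: "smooth W" and psi: "smooth \<psi>" "{x. \<psi> x \<noteq> 0} \<subseteq> K"
    and b: "b \<in> borel_measurable borel" "\<And>x. norm (b x) \<le> B"
  defines "\<phi> \<equiv> (\<lambda>x. exp (W x) * \<psi> x)"
  shows "\<phi> \<in> test_functions S"
    and "(LINT x|lebesgue_on S. Du x \<bullet> grad \<phi> x + (b x \<bullet> Du x) * \<phi> x) =
      - (LINT x|lebesgue_on S. u x * (exp (W x) * (laplacian \<psi> x + grad W x \<bullet> grad \<psi> x))) +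
      (LINT x|lebesgue_on S. Du x \<bullet> (\<phi> x *\<^sub>R (grad W x + b x)))"
    and "integrable (lebesgue_on S) (\<lambda>x. u x * (exp (W x) * (laplacian \<psi> x + grad W x \<bullet> grad \<psi> x)))"
    and "integrable (lebesgue_on S) (\<lambda>x. Du x \<bullet> (\<phi> x *\<^sub>R (grad W x + b x)))"
proof -
  have loc: "locally_integrable_on u S" "locally_integrable_on Du S"
    and weak: "\<And>\<eta> i. \<eta> \<in> test_functions S \<Longrightarrow> i \<in> Basis \<Longrightarrow>
       (LINT x|lebesgue_on S. u x * (grad \<eta> x \<bullet> i)) = - (LINT x|lebesgue_on S. (Du x \<bullet> i) * \<eta> x)"
    using wg by (auto simp: is_weak_gradient_def)
  have cK: "closed K" using K(1) by (rule compact_imp_closed)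
  have \<psi>0: "\<psi> x = 0" if "x \<notin> K" for x using psi(2) that by auto
  define E where "E x = exp (W x)" for x
  have smE: "smooth E" unfolding E_def[abs_def] by (rule smooth_compose[OF smooth_exp W])
  have DE: "GDERIV E x :> E x *\<^sub>R grad W x" for x
    unfolding E_def[abs_def] by (rule GDERIV_DERIV_compose[OF smooth_GDERIV[OF W] DERIV_exp])
  have sm_\<phi>: "smooth \<phi>" unfolding \<phi>_def using smooth_mult[OF smE psi(1)] by (simp add: E_def)
  have \<phi>0: "\<phi> x = 0" if "x \<notin> K" for x using \<psi>0[OF that] by (simp add: \<phi>_def)
  show test: "\<phi> \<in> test_functions S"
    by (rule test_functionsI[OF sm_\<phi> K \<phi>0])
  have grad_\<phi>: "grad \<phi> x = E x *\<^sub>R grad \<psi> x + \<phi> x *\<^sub>R grad W x" for x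
    using GDERIV_imp_grad[OF GDERIV_mult[OF DE smooth_GDERIV[OF psi(1)]]]
    by (simp add: \<phi>_def E_def mult.commute)
  \<comment> \<open>The integration by parts is the definition of the weak gradient, applied to each component of \<open>exp W *\<^sub>R \<nabla> \<psi>\<close>.\<close>
  define \<eta> where "\<eta> i x = E x * (grad \<psi> x \<bullet> i)" for i x
  have sm_\<eta>: "smooth (\<eta> i)" if "i \<in> Basis" for i
    unfolding \<eta>_def[abs_def] by (intro smooth_mult smE smooth_grad psi that)
  have grad_\<psi>0: "grad \<psi> x = 0" if "x \<notin> K" for x
    by (rule grad_eq_0_outside[OF cK \<psi>0 that])
  have \<eta>0: "\<eta> i x = 0" if "x \<notin> K" for i x
    using grad_\<psi>0[OF that] by (simp add: \<eta>_def)
  have \<eta>_test: "\<eta> i \<in> test_functions S" if "i \<in> Basis" for i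
    by (rule test_functionsI[OF sm_\<eta>[OF that] K \<eta>0])
  have grad_\<eta>: "grad (\<eta> i) x \<bullet> i =
      E x * (grad (\<lambda>x. grad \<psi> x \<bullet> i) x \<bullet> i) + E x * ((grad W x \<bullet> i) * (grad \<psi> x \<bullet> i))"
    if "i \<in> Basis" for i x
    using GDERIV_imp_grad[OF GDERIV_mult[OF DE smooth_GDERIV[OF smooth_grad[OF psi(1) that]]]]
    unfolding \<eta>_def[abs_def] by (simp add: inner_add_left mult_ac)
  have div: "(\<Sum>i\<in>Basis. grad (\<eta> i) x \<bullet> i) = E x * (laplacian \<psi> x + grad W x \<bullet> grad \<psi> x)" for x
  proof -
    have "grad W x \<bullet> grad \<psi> x = (\<Sum>i\<in>Basis. (grad W x \<bullet> i) * (grad \<psi> x \<bullet> i))"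
      by (rule euclidean_inner)
    then show ?thesis
      by (simp add: grad_\<eta> sum.distrib laplacian_def distrib_left sum_distrib_left)
  qed
  have int_u: "integrable (lebesgue_on S) (\<lambda>x. u x * (grad (\<eta> i) x \<bullet> i))" if "i \<in> Basis" for i
    using grad_eq_0_outside[OF cK \<eta>0]
    by (intro integrable_mult_compact_support[OF loc(1) S K] smooth_continuous smooth_grad sm_\<eta> that) auto
  have int_Du: "integrable (lebesgue_on S) (\<lambda>x. (Du x \<bullet> i) * \<eta> i x)" if "i \<in> Basis" for i
  proof -
    have c: "continuous_on UNIV (\<lambda>x. \<eta> i x *\<^sub>R i)"
      using smooth_continuous[OF sm_\<eta>[OF that]] by (intro continuous_intros)
    obtain B' where "\<And>x. x \<in> K \<Longrightarrow> norm (\<eta> i x *\<^sub>R i) \<le> B'"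
      using compact_imp_bounded[OF compact_continuous_image[OF continuous_on_subset[OF c subset_UNIV] K(1)]]
      by (auto simp: bounded_iff)
    then have "integrable (lebesgue_on S) (\<lambda>x. Du x \<bullet> (\<eta> i x *\<^sub>R i))"
      using \<eta>0 by (intro integrable_inner_compact_support[OF loc(2) S K borel_measurable_continuous_onI[OF c]]) auto
    then show ?thesis by (simp add: mult.commute)
  qed
  have sum_u: "u x * (E x * (laplacian \<psi> x + grad W x \<bullet> grad \<psi> x)) = (\<Sum>i\<in>Basis. u x * (grad (\<eta> i) x \<bullet> i))" for x
    by (simp only: div sum_distrib_left[symmetric])
  show "integrable (lebesgue_on S) (\<lambda>x. u x * (exp (W x) * (laplacian \<psi> x + grad W x \<bullet> grad \<psi> x)))"
    using int_u unfolding E_def[symmetric] sum_u by (intro Bochner_Integration.integrable_sum)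
  have c: "continuous_on UNIV (\<lambda>x. \<phi> x *\<^sub>R grad W x)" "continuous_on UNIV \<phi>"
    using smooth_continuous[OF sm_\<phi>] continuous_grad[OF W] by (auto intro: continuous_intros)
  obtain B1 where B1: "\<And>x. x \<in> K \<Longrightarrow> norm (\<phi> x *\<^sub>R grad W x) \<le> B1"
    using compact_imp_bounded[OF compact_continuous_image[OF continuous_on_subset[OF c(1) subset_UNIV] K(1)]]
    by (auto simp: bounded_iff)
  obtain B2 where B2: "\<And>x. x \<in> K \<Longrightarrow> norm (\<phi> x) \<le> B2"
    using compact_imp_bounded[OF compact_continuous_image[OF continuous_on_subset[OF c(2) subset_UNIV] K(1)]]
    by (auto simp: bounded_iff)
  show int_E: "integrable (lebesgue_on S) (\<lambda>x. Du x \<bullet> (\<phi> x *\<^sub>R (grad W x + b x)))"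
  proof (rule integrable_inner_compact_support[OF loc(2) S K])
    show "(\<lambda>x. \<phi> x *\<^sub>R (grad W x + b x)) \<in> borel_measurable borel"
      using borel_measurable_continuous_onI[OF c(2)]
        borel_measurable_continuous_onI[OF continuous_grad[OF W]] b(1) by measurable
    show "norm (\<phi> x *\<^sub>R (grad W x + b x)) \<le> B1 + B2 * B" if "x \<in> K" for x
    proof -
      have "norm (\<phi> x *\<^sub>R (grad W x + b x)) \<le> norm (\<phi> x *\<^sub>R grad W x) + norm (\<phi> x) * norm (b x)"
        unfolding scaleR_add_right by (metis norm_scaleR norm_triangle_ineq real_norm_def)
      also have "\<dots> \<le> B1 + B2 * B"
        using B1[OF that] B2[OF that] b(2)[of x] by (intro add_mono mult_mono) (auto intro: order_trans[OF norm_ge_zero])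
      finally show ?thesis .
    qed
  qed (simp add: \<phi>0)
  have pw: "Du x \<bullet> grad \<phi> x + (b x \<bullet> Du x) * \<phi> x =
      (\<Sum>i\<in>Basis. (Du x \<bullet> i) * \<eta> i x) + Du x \<bullet> (\<phi> x *\<^sub>R (grad W x + b x))" for x
  proof -
    have "(\<Sum>i\<in>Basis. (Du x \<bullet> i) * \<eta> i x) = E x * (\<Sum>i\<in>Basis. (Du x \<bullet> i) * (grad \<psi> x \<bullet> i))"
      unfolding \<eta>_def sum_distrib_left by (intro sum.cong) auto
    also have "\<dots> = E x * (Du x \<bullet> grad \<psi> x)" by (rule arg_cong[OF euclidean_inner[symmetric]])
    finally show ?thesis
      by (simp add: grad_\<phi> inner_add_right inner_commute[of "b x"] algebra_simps)
  qed
  have "(LINT x|lebesgue_on S. Du x \<bullet> grad \<phi> x + (b x \<bullet> Du x) * \<phi> x) =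
      (\<Sum>i\<in>Basis. (LINT x|lebesgue_on S. (Du x \<bullet> i) * \<eta> i x)) +
      (LINT x|lebesgue_on S. Du x \<bullet> (\<phi> x *\<^sub>R (grad W x + b x)))"
    unfolding pw using int_Du int_E
    by (simp add: Bochner_Integration.integral_add Bochner_Integration.integral_sum)
  also have "(\<Sum>i\<in>Basis. (LINT x|lebesgue_on S. (Du x \<bullet> i) * \<eta> i x)) =
      - (\<Sum>i\<in>Basis. (LINT x|lebesgue_on S. u x * (grad (\<eta> i) x \<bullet> i)))"
    using weak[OF \<eta>_test] by (simp add: sum_negf)
  also have "(\<Sum>i\<in>Basis. (LINT x|lebesgue_on S. u x * (grad (\<eta> i) x \<bullet> i))) =
      (LINT x|lebesgue_on S. u x * (exp (W x) * (laplacian \<psi> x + grad W x \<bullet> grad \<psi> x)))"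
    unfolding E_def[symmetric] sum_u using int_u
    by (simp add: Bochner_Integration.integral_sum)
  finally show "(LINT x|lebesgue_on S. Du x \<bullet> grad \<phi> x + (b x \<bullet> Du x) * \<phi> x) =
      - (LINT x|lebesgue_on S. u x * (exp (W x) * (laplacian \<psi> x + grad W x \<bullet> grad \<psi> x))) +
      (LINT x|lebesgue_on S. Du x \<bullet> (\<phi> x *\<^sub>R (grad W x + b x)))" .
qed

section \<open>The lower bound\<close>

lemma abs_diff_le_of_grad_bound:
  fixes f :: "'a::euclidean_space \<Rightarrow> real"
  assumes f: "smooth f" and K: "convex K" "x \<in> K" "y \<in> K"
    and bound: "\<And>x. x \<in> K \<Longrightarrow> norm (grad f x) \<le> B"
  shows "\<bar>f x - f y\<bar> \<le> B * norm (x - y)"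
proof -
  have "norm (f x - f y) \<le> B * norm (x - y)"
  proof (rule differentiable_bound[OF K(1) _ _ K(2,3)])
    show "(f has_derivative (\<lambda>h. h \<bullet> grad f x)) (at x within K)" if "x \<in> K" for x
      using smooth_GDERIV[OF f, of x] unfolding gderiv_def by (rule has_derivative_at_withinI)
    show "onorm (\<lambda>h. h \<bullet> grad f x) \<le> B" if "x \<in> K" for x
    proof (rule onorm_le)
      fix h
      have "norm (h \<bullet> grad f x) \<le> norm h * norm (grad f x)"
        unfolding real_norm_def by (rule Cauchy_Schwarz_ineq2)
      also have "\<dots> \<le> norm h * B" using bound[OF that] by (rule mult_left_mono) simp
      finally show "norm (h \<bullet> grad f x) \<le> B * norm h" by (simp only: mult.commute)
    qed
  qed
  then show ?thesis by simp
qed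

lemma cball_subset_unit_ball:
  assumes "norm y + R < 1"
  shows "cball y R \<subseteq> ball (0::'a::euclidean_space) 1"
proof
  fix x assume "x \<in> cball y R"
  then have "norm (x - y) \<le> R" by (simp add: dist_norm norm_minus_commute)
  then show "x \<in> ball 0 1" using norm_triangle_ineq[of y "x - y"] assms by simp
qed

text \<open>The equation with pole \<open>z\<close> is tested with \<open>exp (W k) * \<psi>\<close>, where \<open>\<psi>\<close> is the barrier centred at
the evaluation point \<open>y\<close> with core radius \<open>t\<close>, and \<open>W k\<close> approximates the potential of the drift.
Because \<open>u\<close> is nonnegative, the subsolution inequality for \<open>\<psi>\<close> leaves only the values of \<open>u\<close> in the
core. On the ball of radius \<open>3 / 4 * \<delta>\<close> about \<open>y\<close> the distance to the boundary is at least \<open>\<delta> / 4\<close>;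
there the gradients of the approximate potentials are at most \<open>12 * C / \<delta>\<close>, and these potentials
differ from their value at \<open>y\<close> by at most \<open>9 * C\<close>.\<close>

lemma barrier_test_inequality:
  fixes y z :: "'a::euclidean_space" and u :: "'a \<Rightarrow> real"
  defines "n \<equiv> real DIM('a)" and "\<delta> \<equiv> 1 - norm y"
  assumes C: "C \<ge> 1" and m: "m > 0"
    and wg: "is_weak_gradient (ball 0 1) u Du"
    and eqn: "\<And>\<phi>. \<phi> \<in> test_functions (ball 0 1) \<Longrightarrow>
      (LINT x|lebesgue_on (ball 0 1). Du x \<bullet> grad \<phi> x + (drift C m x \<bullet> Du x) * \<phi> x) = \<phi> z"
    and nonneg: "\<And>x. x \<in> ball 0 1 \<Longrightarrow> u x \<ge> 0"
    and yz: "norm y < 1" "norm (z - y) \<le> \<delta> / 2" "y \<noteq> z"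
    and t: "0 < t" "t \<le> norm (z - y)" "12 * C / \<delta> * t \<le> 1"
    and sup: "\<And>x. dist y x < t \<Longrightarrow> u x \<le> M"
  shows "exp (- 9 * C) * ramp (5 / 8 * (norm (z - y))\<^sup>2 * (2 / (3 * norm (z - y))) ^ DIM('a) * exp (- 9 * C))
    \<le> 2 * exp (9 * C) * core_const n * unit_ball_vol n * M"
proof -
  define R where "R = 3 / 4 * \<delta>"
  define K where "K = 12 * C / \<delta>"
  define B where "B = cball y R"
  define S where "S = (ball 0 1 :: 'a set)"
  have \<delta>: "\<delta> > 0" using yz by (simp add: \<delta>_def)
  have R0: "R > 0" using \<delta> by (simp add: R_def)
  have R1: "norm y + R < 1" 
    using \<delta> unfolding R_def \<delta>_def by argo
  note R = R0 R1
  have K: "K > 0" using C \<delta> by (simp add: K_def)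
  have KR: "K * R = 9 * C" using \<delta> by (simp add: K_def R_def)
  have BS: "compact B" "B \<subseteq> S" "convex B"
    using cball_subset_unit_ball[OF R(2)] by (auto simp: B_def S_def)
  have S: "S \<in> sets lebesgue" by (simp add: S_def)
  have tR: "t \<le> R" using t(2) yz(2) \<delta> by (simp add: R_def)
  have zB: "z \<in> B" using yz(2) \<delta> by (simp add: B_def R_def dist_norm norm_minus_commute)
  have yB: "y \<in> B" using R by (simp add: B_def)
  define a where "a = t\<^sup>2"
  have a: "0 < a" "a \<le> R\<^sup>2" "K * sqrt a \<le> 1" "sqrt a = t" "a \<le> (norm (z - y))\<^sup>2"
    using t tR by (auto simp: a_def K_def intro: power_mono)
  obtain \<psi> where \<psi>: "smooth \<psi>" "\<And>x. \<psi> x \<ge> 0" "\<And>x. norm (x - y) \<ge> R \<Longrightarrow> \<psi> x = 0"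
    and sub: "\<And>x V. norm V \<le> K \<Longrightarrow> laplacian \<psi> x + V \<bullet> grad \<psi> x \<ge>
       - (2 * core_const n * a powr (- n / 2)) * indicator (ball y (sqrt a)) x"
    and low: "\<And>z. a \<le> (norm (z - y))\<^sup>2 \<Longrightarrow> norm (z - y) \<le> 2 / 3 * R \<Longrightarrow>
       \<psi> z \<ge> ramp (5 / 8 * (norm (z - y))\<^sup>2 * (2 / (3 * norm (z - y))) ^ DIM('a) * exp (- K * R))"
    using barrier_exists[OF K R(1) a(1,2,3), of y, folded n_def] by blast
  obtain W0 :: "nat \<Rightarrow> 'a \<Rightarrow> real" where W0: "\<And>k. smooth (W0 k)"
    "\<And>k x. norm x < 1 \<Longrightarrow> norm (grad (W0 k) x) \<le> 3 * C / (1 - norm x)"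
    "\<And>x. norm x < 1 \<Longrightarrow> (\<lambda>k. grad (W0 k) x) \<longlonglongrightarrow> - drift C m x"
    using drift_potential[OF C m] by blast
  \<comment> \<open>Normalised at \<open>y\<close>, the potentials are bounded on \<open>B\<close> uniformly in \<open>k\<close>.\<close>
  define W where "W k x = W0 k x - W0 k y" for k x
  have sm_W: "smooth (W k)" for k unfolding W_def[abs_def] by (intro smooth_diff W0 smooth_const)
  have grad_W: "grad (W k) x = grad (W0 k) x" for k x
    using GDERIV_imp_grad[OF GDERIV_diff[OF smooth_GDERIV[OF W0(1)] GDERIV_const]]
    unfolding W_def[abs_def] by simp
  have grad_bound: "norm (grad (W k) x) \<le> K" if "x \<in> B" for k x
  proof -
    have "norm (x - y) \<le> R" using that by (simp add: B_def dist_norm norm_minus_commute)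
    then have x: "\<delta> / 4 \<le> 1 - norm x"
      using norm_triangle_ineq[of y "x - y"] by (simp add: R_def \<delta>_def)
    then have "norm (grad (W k) x) \<le> 3 * C / (1 - norm x)"
      unfolding grad_W using \<delta> by (intro W0(2)) linarith
    also have "\<dots> \<le> 3 * C / (\<delta> / 4)"
      using x \<delta> C by (intro divide_left_mono) auto
    finally show ?thesis by (simp add: K_def)
  qed
  have W_bound: "\<bar>W k x\<bar> \<le> 9 * C" if "x \<in> B" for k x
  proof -
    have "\<bar>W k x - W k y\<bar> \<le> K * norm (x - y)"
      by (rule abs_diff_le_of_grad_bound[OF sm_W BS(3) that yB grad_bound])
    also have "\<dots> \<le> K * R"
      using that K by (intro mult_left_mono) (auto simp: B_def dist_norm norm_minus_commute)
    finally show ?thesis by (simp add: KR W_def)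
  qed
  have \<psi>0: "\<psi> x = 0" if "x \<notin> B" for x
    using that by (intro \<psi>(3)) (simp add: B_def dist_norm norm_minus_commute)
  then have supp: "{x. \<psi> x \<noteq> 0} \<subseteq> B" by auto
  define \<phi> where "\<phi> k x = exp (W k x) * \<psi> x" for k x
  have bm: "drift C m \<in> borel_measurable (borel :: 'a measure)" by (rule drift_measurable[OF m])
  have bb: "norm (drift C m x) \<le> C * real m" for x :: 'a using C by (intro norm_drift_le m) simp
  note wwf = weighted_weak_form[OF wg[folded S_def] S BS(1,2) sm_W \<psi>(1) supp bm bb, folded \<phi>_def]
  define I where "I k = (LINT x|lebesgue_on S. u x * (exp (W k x) * (laplacian \<psi> x + grad (W k) x \<bullet> grad \<psi> x)))" for k
  define E where "E k = (LINT x|lebesgue_on S. Du x \<bullet> (\<phi> k x *\<^sub>R (grad (W k) x + drift C m x)))" for k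
  have identity: "\<phi> k z = - I k + E k" for k
    using wwf(2)[of k] eqn[folded S_def, OF wwf(1)] by (simp add: I_def E_def)
  define Q where "Q = exp (9 * C) * (2 * core_const n * a powr (- n / 2)) * M"
  have M: "M \<ge> 0"
    using order_trans[OF nonneg sup[of y]] yz(1) t(1) by simp
  have core0: "core_const n \<ge> 0" by (simp add: core_const_def n_def)
  have ball_sub: "ball y t \<subseteq> S" using BS(2) tR by (auto simp: B_def)
  have measure_ball: "measure (lebesgue_on S) (ball y t) = unit_ball_vol n * t powr n"
    using ball_sub S t(1) by (simp add: measure_restrict_space content_ball n_def powr_realpow)
  have I_bound: "- I k \<le> Q * (unit_ball_vol n * t powr n)" for k
  proof -
    have "- I k = (LINT x|lebesgue_on S. - (u x * (exp (W k x) * (laplacian \<psi> x + grad (W k) x \<bullet> grad \<psi> x))))"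
      by (simp add: I_def)
    also have "\<dots> \<le> (LINT x|lebesgue_on S. Q * indicator (ball y t) x)"
    proof (rule integral_mono)
      show "integrable (lebesgue_on S) (\<lambda>x. - (u x * (exp (W k x) * (laplacian \<psi> x + grad (W k) x \<bullet> grad \<psi> x))))"
        using wwf(3) by (intro Bochner_Integration.integrable_minus)
      show "integrable (lebesgue_on S) (\<lambda>x. Q * indicator (ball y t) x)"
      proof (intro integrable_mult_right integrable_real_indicator)
        show "ball y t \<in> sets (lebesgue_on S)" using ball_sub S by (simp add: sets_restrict_space_iff)
        show "emeasure (lebesgue_on S) (ball y t) < \<infinity>"
          using ball_sub S emeasure_lborel_ball_finite[of y t] by (simp add: emeasure_restrict_space)
      qed
      fix x assume "x \<in> space (lebesgue_on S)"
      then have xS: "x \<in> S" by simp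
      let ?L = "laplacian \<psi> x + grad (W k) x \<bullet> grad \<psi> x"
      show "- (u x * (exp (W k x) * ?L)) \<le> Q * indicator (ball y t) x"
      proof (cases "x \<in> B")
        case False
        have cB: "closed B" by (simp add: B_def)
        have g0: "grad \<psi> x = 0" if "x \<notin> B" for x by (rule grad_eq_0_outside[OF cB \<psi>0 that])
        have "grad (\<lambda>x. grad \<psi> x \<bullet> i) x = 0" for i
          by (rule grad_eq_0_outside[OF cB _ False]) (simp add: g0)
        then have "?L = 0" by (simp add: laplacian_def g0[OF False])
        then show ?thesis using M core0 by (simp add: Q_def)
      next
        case True
        let ?c = "2 * core_const n * a powr (- n / 2)"
        have L: "- ?L \<le> ?c * indicator (ball y t) x"
          using sub[OF grad_bound[OF True, of k], of x] by (simp add: a(4))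
        have u0: "u x \<ge> 0" using nonneg xS by (simp add: S_def)
        have c0: "?c \<ge> 0" using core0 by simp
        have "- (u x * (exp (W k x) * ?L)) = exp (W k x) * (u x * - ?L)"
          by (simp only: mult_minus_right mult.left_commute)
        also have "\<dots> \<le> exp (W k x) * (u x * (?c * indicator (ball y t) x))"
          using L u0 by (intro mult_left_mono) auto
        also have "\<dots> \<le> exp (9 * C) * (M * (?c * indicator (ball y t) x))"
        proof (cases "x \<in> ball y t")
          case True
          then show ?thesis
            using sup[of x] u0 c0 W_bound[OF \<open>x \<in> B\<close>, of k] M
            by (intro mult_mono mult_right_mono) auto
        qed simp
        also have "\<dots> = Q * indicator (ball y t) x" by (simp add: Q_def)
        finally show ?thesis .
      qed
    qed
    also have "\<dots> = Q * measure (lebesgue_on S) (ball y t)"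
      using ball_sub S by (simp add: sets_restrict_space_iff Int_absorb2)
    finally show ?thesis by (simp only: measure_ball)
  qed
  obtain P where P: "\<And>x. x \<in> B \<Longrightarrow> \<bar>\<psi> x\<bar> \<le> P"
    using compact_imp_bounded[OF compact_continuous_image[OF continuous_on_subset[OF smooth_continuous[OF \<psi>(1)] subset_UNIV] BS(1)]]
    by (auto simp: bounded_iff)
  \<comment> \<open>The error term vanishes in the limit by dominated convergence: \<open>grad (W k) + drift\<close> tends to \<open>0\<close> boundedly on \<open>B\<close>, and \<open>Du\<close> is integrable there.\<close>
  have "E \<longlonglongrightarrow> (LINT x|lebesgue_on S. 0)"
    unfolding E_def[abs_def]
  proof (rule integral_dominated_convergence)
    let ?w = "\<lambda>x. (exp (9 * C) * P * (K + C * real m)) * norm (indicator B x *\<^sub>R Du x)"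
    have "locally_integrable_on Du S" using wg by (simp add: is_weak_gradient_def S_def)
    then have "integrable (lebesgue_on B) Du" using BS by (simp add: locally_integrable_on_def)
    then have "integrable lebesgue (\<lambda>x. indicator B x *\<^sub>R Du x)"
      by (simp add: integrable_restrict_space set_integrable_def B_def)
    also have "(\<lambda>x. indicator B x *\<^sub>R Du x) = (\<lambda>x. indicator S x *\<^sub>R (indicator B x *\<^sub>R Du x))"
      using BS(2) by (auto simp: indicator_def fun_eq_iff)
    finally have "integrable (lebesgue_on S) (\<lambda>x. indicator B x *\<^sub>R Du x)"
      using S by (simp add: integrable_restrict_space set_integrable_def)
    then show "integrable (lebesgue_on S) ?w"
      by (intro integrable_mult_right integrable_norm)
    show "(\<lambda>x. Du x \<bullet> (\<phi> k x *\<^sub>R (grad (W k) x + drift C m x))) \<in> borel_measurable (lebesgue_on S)" for k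
      using wwf(4) by (rule borel_measurable_integrable)
    show "AE x in lebesgue_on S. norm (Du x \<bullet> (\<phi> k x *\<^sub>R (grad (W k) x + drift C m x))) \<le> ?w x" for k
    proof (intro AE_I2)
      fix x
      show "norm (Du x \<bullet> (\<phi> k x *\<^sub>R (grad (W k) x + drift C m x))) \<le> ?w x"
      proof (cases "x \<in> B")
        case True
        have "norm (Du x \<bullet> (\<phi> k x *\<^sub>R (grad (W k) x + drift C m x))) \<le>
            norm (Du x) * (exp (W k x) * \<bar>\<psi> x\<bar> * norm (grad (W k) x + drift C m x))"
          using Cauchy_Schwarz_ineq2[of "Du x" "\<phi> k x *\<^sub>R (grad (W k) x + drift C m x)"]
          by (simp add: \<phi>_def abs_mult)
        also have "\<dots> \<le> norm (Du x) * (exp (9 * C) * P * (K + C * real m))"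
          using W_bound[OF True, of k] P[OF True] grad_bound[OF True, of k] bb[of x]
          by (intro mult_left_mono mult_mono order_trans[OF norm_triangle_ineq] add_mono)
            (auto intro: order_trans[OF abs_ge_zero])
        finally show ?thesis using True by (simp add: mult.commute)
      qed (simp add: \<phi>_def \<psi>0)
    qed
    show "AE x in lebesgue_on S. (\<lambda>k. Du x \<bullet> (\<phi> k x *\<^sub>R (grad (W k) x + drift C m x))) \<longlonglongrightarrow> 0"
    proof (intro AE_I2)
      fix x assume "x \<in> space (lebesgue_on S)"
      then have x: "norm x < 1" by (simp add: S_def)
      show "(\<lambda>k. Du x \<bullet> (\<phi> k x *\<^sub>R (grad (W k) x + drift C m x))) \<longlonglongrightarrow> 0"
      proof (cases "x \<in> B")
        case True
        have "(\<lambda>k. grad (W k) x + drift C m x) \<longlonglongrightarrow> - drift C m x + drift C m x"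
          unfolding grad_W by (intro tendsto_add W0(3) x tendsto_const)
        then have lim0: "(\<lambda>k. norm (grad (W k) x + drift C m x)) \<longlonglongrightarrow> 0"
          using tendsto_norm by fastforce
        have "(\<lambda>k. (norm (Du x) * (exp (9 * C) * P)) * norm (grad (W k) x + drift C m x)) \<longlonglongrightarrow> 0"
          by (rule tendsto_mult_right_zero[OF lim0])
        then show ?thesis
        proof (rule Lim_null_comparison[rotated], intro always_eventually allI)
          fix k
          have "norm (Du x \<bullet> (\<phi> k x *\<^sub>R (grad (W k) x + drift C m x))) \<le>
              norm (Du x) * (exp (W k x) * \<bar>\<psi> x\<bar> * norm (grad (W k) x + drift C m x))"
            using Cauchy_Schwarz_ineq2[of "Du x" "\<phi> k x *\<^sub>R (grad (W k) x + drift C m x)"]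
            by (simp add: \<phi>_def abs_mult)
          also have "\<dots> \<le> norm (Du x) * (exp (9 * C) * P * norm (grad (W k) x + drift C m x))"
            using W_bound[OF True, of k] P[OF True]
            by (intro mult_left_mono mult_right_mono mult_mono) auto
          finally show "norm (Du x \<bullet> (\<phi> k x *\<^sub>R (grad (W k) x + drift C m x))) \<le>
              norm (Du x) * (exp (9 * C) * P) * norm (grad (W k) x + drift C m x)"
            by (simp only: mult.assoc)
        qed
      qed (simp add: \<phi>_def \<psi>0)
    qed
  qed simp
  then have E0: "E \<longlonglongrightarrow> 0" by simp
  define A where "A = exp (- 9 * C) * \<psi> z"
  have "A \<le> Q * (unit_ball_vol n * t powr n) + E k" for k
  proof -
    have "A \<le> exp (W k z) * \<psi> z"
      unfolding A_def using W_bound[OF zB, of k] \<psi>(2)[of z] by (intro mult_right_mono) auto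
    then show ?thesis using identity[of k] I_bound[of k] by (simp add: \<phi>_def)
  qed
  moreover have "(\<lambda>k. Q * (unit_ball_vol n * t powr n) + E k) \<longlonglongrightarrow> Q * (unit_ball_vol n * t powr n) + 0"
    by (intro tendsto_add tendsto_const E0)
  ultimately have "A \<le> Q * (unit_ball_vol n * t powr n) + 0"
    by (intro LIMSEQ_le_const) auto
  also have "\<dots> = 2 * exp (9 * C) * core_const n * unit_ball_vol n * M"
  proof -
    have "a powr (- n / 2) = t powr (- n)"
      using t(1) by (simp add: a_def powr_powr flip: powr_numeral)
    then have "a powr (- n / 2) * t powr n = 1"
      using t(1) by (simp add: powr_minus)
    moreover have "Q * (unit_ball_vol n * t powr n) + 0 =
        2 * exp (9 * C) * core_const n * unit_ball_vol n * M * (a powr (- n / 2) * t powr n)"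
      by (simp add: Q_def)
    ultimately show ?thesis by simp
  qed
  finally have "A \<le> 2 * exp (9 * C) * core_const n * unit_ball_vol n * M" .
  moreover have "norm (z - y) \<le> 2 / 3 * R" using yz(2) by (simp add: R_def)
  then have "ramp (5 / 8 * (norm (z - y))\<^sup>2 * (2 / (3 * norm (z - y))) ^ DIM('a) * exp (- 9 * C)) \<le> \<psi> z"
    using low[OF a(5)] KR by simp
  then have "exp (- 9 * C) * ramp (5 / 8 * (norm (z - y))\<^sup>2 * (2 / (3 * norm (z - y))) ^ DIM('a) * exp (- 9 * C)) \<le> A"
    unfolding A_def by (rule mult_left_mono) simp
  ultimately show ?thesis by linarith
qed

lemma infdist_unit_sphere_le:
  fixes y :: "'a::euclidean_space"
  assumes "norm y < 1"
  shows "infdist y (frontier (ball 0 1)) \<le> 1 - norm y"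
proof -
  obtain p :: 'a where p: "norm p = 1" "y = norm y *\<^sub>R p"
  proof (cases "y = 0")
    case True
    then show ?thesis using that[of "SOME i. i \<in> Basis"] by (simp add: norm_some_Basis)
  next
    case False
    then show ?thesis using that[of "sgn y"] by (simp add: norm_sgn sgn_div_norm)
  qed
  have "y - p = (norm y - 1) *\<^sub>R p"
    by (subst p(2)) (simp add: scaleR_diff_left)
  then have "dist y p = 1 - norm y"
    using p(1) assms by (simp add: dist_norm)
  moreover have "p \<in> frontier (ball 0 1)" using p(1) by (simp add: frontier_ball)
  ultimately show ?thesis using infdist_le by metis
qed

text \<open>Continuity of the Green's function off its pole lets the core of the barrier shrink to \<open>y\<close>.\<close>

lemma Green_function_lower_bound:
  fixes y z :: "'a::euclidean_space"
  defines "n \<equiv> real DIM('a)"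
  assumes C: "C \<ge> 1" and m: "m > 0" and G: "is_Green_function (drift C m) G"
    and y: "norm y < 1" and z: "norm z < 1" "y \<noteq> z"
    and near: "norm (z - y) \<le> (1 - norm y) / 2"
  shows "ereal (exp (- 9 * C) * ramp (5 / 8 * (norm (z - y))\<^sup>2 * (2 / (3 * norm (z - y))) ^ DIM('a) * exp (- 9 * C))
    / (2 * exp (9 * C) * core_const n * unit_ball_vol n)) \<le> G y z" (is "ereal (?A / ?D) \<le> _")
proof -
  define u where "u = (\<lambda>x. real_of_ereal (G x z))"
  define Du where "Du = weak_grad (ball 0 1) u"
  have z_in: "z \<in> ball 0 1" and y_in: "y \<in> ball 0 1" using y z by auto
  have G0: "0 \<le> G x z" if "x \<in> ball 0 1" for x
    using G that z_in by (simp add: is_Green_function_def)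
  have Green: "(\<forall>s>0. (\<forall>x\<in>ball 0 1 - ball z s. G x z \<noteq> \<infinity>) \<and>
        continuous_on (ball 0 1 - ball z s) u \<and>
        u \<in> W1p 2 (interior (ball 0 1 - ball z s)) \<and> u \<in> W1p 1 (ball 0 1)) \<and>
      (\<forall>\<phi>\<in>test_functions (ball 0 1).
        (LINT x|lebesgue_on (ball 0 1). Du x \<bullet> grad \<phi> x + (drift C m x \<bullet> Du x) * \<phi> x) = \<phi> z) \<and>
      u \<in> W1p_zero_trace 1 (ball 0 1)"
    using bspec[OF conjunct2[OF G[unfolded is_Green_function_def Let_def]] z_in]
    unfolding Du_def u_def .
  have reg: "(\<forall>x\<in>ball 0 1 - ball z s. G x z \<noteq> \<infinity>) \<and>
      continuous_on (ball 0 1 - ball z s) u \<and> u \<in> W1p 1 (ball 0 1)" if "s > 0" for s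
    using conjunct1[OF Green] that by simp
  have eqn: "(LINT x|lebesgue_on (ball 0 1). Du x \<bullet> grad \<phi> x + (drift C m x \<bullet> Du x) * \<phi> x) = \<phi> z"
    if "\<phi> \<in> test_functions (ball 0 1)" for \<phi>
    using bspec[OF conjunct1[OF conjunct2[OF Green]] that] .
  have "\<exists>g. is_weak_gradient (ball 0 1) u g"
    using reg[of 1] by (auto simp: W1p_def)
  then have wg: "is_weak_gradient (ball 0 1) u Du"
    unfolding Du_def weak_grad_def by (rule someI_ex)
  have nonneg: "u x \<ge> 0" if "x \<in> ball 0 1" for x
    using G0[OF that] by (simp add: u_def real_of_ereal_pos)
  define q where "q = norm (z - y)"
  have q: "q > 0" "dist y z = q" using z(2) by (auto simp: q_def dist_norm norm_minus_commute)
  have "G y z \<noteq> \<infinity>"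
    using reg[OF q(1)] y_in q(2) by (simp add: dist_commute)
  then have Gu: "G y z = ereal (u y)"
    using G0[OF y_in] by (cases "G y z") (auto simp: u_def)
  have D: "?D > 0"
    by (simp add: core_const_def n_def add_nonneg_pos)
  have "?A / ?D \<le> u y"
  proof (rule field_le_epsilon)
    fix e :: real assume e: "e > 0"
    have "continuous_on (ball 0 1 - ball z (q / 2)) u" using reg[of "q / 2"] q by simp
    moreover have "y \<in> ball 0 1 - ball z (q / 2)" using y_in q by (simp add: dist_commute)
    ultimately obtain d where d: "d > 0"
      "\<And>x. x \<in> ball 0 1 - ball z (q / 2) \<Longrightarrow> dist x y < d \<Longrightarrow> dist (u x) (u y) < e"
      using e unfolding continuous_on_iff by blast
    define t where "t = min d (min (q / 2) ((1 - norm y) / (12 * C)))"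
    have t: "t > 0" "t \<le> q / 2" "t \<le> d" "t \<le> (1 - norm y) / (12 * C)"
      using d(1) q y C by (auto simp: t_def)
    have sup: "u x \<le> u y + e" if x: "dist y x < t" for x
    proof -
      have "q / 2 < dist z x"
        using dist_triangle[of y z x] x t(2) q(2) by (simp add: dist_commute)
      moreover have "norm x \<le> norm y + dist y x"
        using norm_triangle_ineq[of y "x - y"] by (simp add: dist_norm norm_minus_commute)
      then have "x \<in> ball 0 1"
        using x t(2) near q(1) y unfolding q_def mem_ball dist_0_norm by argo
      ultimately have "dist (u x) (u y) < e" using x t(3) by (intro d(2)) (auto simp: dist_commute)
      then show ?thesis by (simp add: dist_real_def)
    qed
    have "12 * C / (1 - norm y) * t \<le> 12 * C / (1 - norm y) * ((1 - norm y) / (12 * C))"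
      using t(4) C y by (intro mult_left_mono) auto
    then have t_small: "12 * C / (1 - norm y) * t \<le> 1" using C y by simp
    have "?A \<le> ?D * (u y + e)"
      unfolding n_def
      by (rule barrier_test_inequality[OF C m wg eqn nonneg y near z(2) t(1) _ t_small sup])
        (use t q in \<open>auto simp: q_def\<close>)
    then show "?A / ?D \<le> u y + e"
      using D by (simp add: divide_le_eq mult.commute)
  qed
  then show ?thesis by (simp add: Gu)
qed

text \<open>At arguments \<open>t \<ge> k\<close> the smoothing factor of \<^const>\<open>ramp\<close> is at least \<open>exp (- 1 / k)\<close>.\<close>

lemma ramp_ge:
  assumes "0 < k" "0 < q" "q \<le> 1" "d \<ge> 2"
  shows "ramp (k * q\<^sup>2 / q ^ d) \<ge> k * exp (- (1 / k)) / q ^ (d - 2)"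
proof -
  have "q ^ d = q\<^sup>2 * q ^ (d - 2)" using power_add[of q 2 "d - 2"] assms(4) by (simp only: le_add_diff_inverse)
  then have eq: "k * q\<^sup>2 / q ^ d = k / q ^ (d - 2)" using assms(2) by simp
  have "q ^ (d - 2) \<le> 1" using assms by (simp add: power_le_one)
  then have "1 / (k / q ^ (d - 2)) \<le> 1 / k"
    using assms by (simp add: divide_right_mono)
  then have "k / q ^ (d - 2) * exp (- (1 / k)) \<le> k / q ^ (d - 2) * exp (- (1 / (k / q ^ (d - 2))))"
    using assms by (intro mult_left_mono) auto
  also have "\<dots> = ramp (k / q ^ (d - 2))"
    using assms by (simp add: ramp_def flat_def)
  finally show ?thesis by (simp add: eq)
qed

theorem theorem4:
  fixes C :: real
  assumes "DIM('a::euclidean_space) \<ge> 3" and "C \<ge> 1"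
  shows "\<exists>c0>0. \<forall>m\<ge>100. \<forall>G :: 'a \<Rightarrow> 'a \<Rightarrow> ereal.
           is_Green_function (drift C m) G \<longrightarrow>
           (\<forall>y\<in>ball 0 1. \<forall>z\<in>ball 0 1.
              y \<noteq> z \<and> norm (z - y) \<le> 1 / 2 * infdist y (frontier (ball 0 1)) \<longrightarrow>
              ereal (c0 / norm (z - y) ^ (DIM('a) - 2)) \<le> G y z)"
proof -
  define D where "D = 2 * exp (9 * C) * core_const (real DIM('a)) * unit_ball_vol (real DIM('a))"
  define k where "k = 5 / 8 * (2 / 3) ^ DIM('a) * exp (- 9 * C)"
  define c0 where "c0 = exp (- 9 * C) * (k * exp (- (1 / k))) / D"
  have D: "D > 0" by (simp add: D_def core_const_def add_nonneg_pos)
  have k: "k > 0" by (simp add: k_def)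
  have "ereal (c0 / norm (z - y) ^ (DIM('a) - 2)) \<le> G y z"
    if m: "m \<ge> 100" and G: "is_Green_function (drift C m) G" and y: "y \<in> ball 0 1" and z: "z \<in> ball 0 1"
      and ne: "y \<noteq> z" and near: "norm (z - y) \<le> 1 / 2 * infdist y (frontier (ball 0 1))"
    for m and G :: "'a \<Rightarrow> 'a \<Rightarrow> ereal" and y z
  proof -
    define q where "q = norm (z - y)"
    have near': "norm (z - y) \<le> (1 - norm y) / 2"
      using near infdist_unit_sphere_le[of y] y by simp
    have q: "q > 0" "q \<le> 1"
    proof -
      show "q > 0" using ne by (simp add: q_def)
      show "q \<le> 1" using near' norm_ge_zero[of y] unfolding q_def by argo
    qed
    have A: "5 / 8 * q\<^sup>2 * (2 / (3 * q)) ^ DIM('a) * exp (- 9 * C) = k * q\<^sup>2 / q ^ DIM('a)"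
      by (simp add: k_def power_divide power_mult_distrib mult_ac)
    have "c0 / q ^ (DIM('a) - 2) = exp (- 9 * C) * (k * exp (- (1 / k)) / q ^ (DIM('a) - 2)) / D"
      by (simp add: c0_def)
    also have "\<dots> \<le> exp (- 9 * C) * ramp (k * q\<^sup>2 / q ^ DIM('a)) / D"
      using ramp_ge[OF k q] assms(1) D by (intro divide_right_mono mult_left_mono) auto
    also have "ereal \<dots> \<le> G y z"
      unfolding A[symmetric] unfolding D_def q_def
      using Green_function_lower_bound[OF assms(2) _ G _ _ ne near'] m y z by simp
    finally show ?thesis by (simp add: q_def)
  qed
  moreover have "c0 > 0" using D k by (simp add: c0_def)
  ultimately show ?thesis by blast
qed

end
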